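(* Let $p>3$ be a prime and let \[f(X) = X + \sum_{i=1}^{\infty} a_i X^{i+3} \in \mathbb{F}_p[[X]], \qquad a_i \in \mathbb{F}_p,\] be an element of infinite order in the Nottingham group $\mathcal{N}(\mathbb{F}_p)$, i.e. $f^{\circ m}(X) \neq X$ for all $m \geq 1$. Then $i_n(f) = 3(1 + p + \dots + p^n)$ for all $n \geq 0$ if and only if $a_1 \neq 0$ and \[2a_1^4 - a_2^3 + 2a_1a_2a_3 - a_1^2a_4 \neq 0 \quad \text{in } \mathbb{F}_p.\]
   Context: $\mathcal{N}(\mathbb{F}_p)$ denotes the group, under composition, of formal power series $X + \sum_{i \geq 2} c_i X^i$ with coefficients $c_i \in \mathbb{F}_p$. $f^{\circ m}$ denotes the $m$-fold compositional iterate of $f$. For a nonzero $g \in \mathbb{F}_p((X))$, $\mathrm{val}_X(g)$ is the integer $i$ with $g \in X^i\mathbb{F}_p[[X]] \setminus X^{i+1}\mathbb{F}_p[[X]]$ (and $\mathrm{val}_X(0)=+\infty$). The ramification number of $g$ is $i(g) = \mathrm{val}_X(g(X) - X) - 1$, and the $n$-th ramification number is $i_n(g) = i(g^{\circ p^n})$. *)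

theory Defs
  imports
    "HOL-Library.Extended_Nat"
    "HOL-Computational_Algebra.Formal_Power_Series"
    "Berlekamp_Zassenhaus.Finite_Field"
begin

definition nottingham :: "'a::comm_ring_1 fps set" where
  "nottingham = {f. fps_nth f 0 = 0 \<and> fps_nth f 1 = 1}"

definition fps_iterate :: "'a::comm_ring_1 fps \<Rightarrow> nat \<Rightarrow> 'a fps" where
  "fps_iterate f m = ((\<lambda>g. fps_compose f g) ^^ m) fps_X"

text \<open>
  Unlike \<^const>\<open>subdegree\<close>, which is \<open>0\<close> at \<open>0\<close>, the valuation is \<open>\<infinity>\<close> there.
  For members of \<open>nottingham\<close> the argument \<open>g - fps_X\<close> below has valuation
  at least \<open>2\<close>, so the subtraction of \<open>1\<close> is never truncated, and \<open>\<infinity> - 1 = \<infinity>\<close>.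
\<close>

definition val_X :: "'a::comm_ring_1 fps \<Rightarrow> enat" where
  "val_X g = (if g = 0 then \<infinity> else enat (subdegree g))"

definition ramification :: "'a::comm_ring_1 fps \<Rightarrow> enat" where
  "ramification g = val_X (g - fps_X) - 1"

definition ramification_number :: "nat \<Rightarrow> 'p::prime_card mod_ring fps \<Rightarrow> enat" where
  "ramification_number n g = ramification (fps_iterate g (CARD('p) ^ n))"

end

theory Submission
  imports Defs
begin

text \<open>
  Composition with \<open>f\<close> is a ring endomorphism \<open>T\<close> of power series, and in characteristic \<open>p\<close>
  its truncated logarithm \<open>L = \<Sum>\<^bsub>0<k<p\<^esub> (-1)\<^bsup>k-1\<^esup> (T - 1)\<^bsup>k\<^esup> / k\<close> is a polynomial in \<open>T\<close>
  over the prime field, so the \<open>p\<close>-th power of \<open>L\<close> is the truncated logarithm of \<open>T\<^sup>p\<close>.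
  Up to terms of relative order \<open>p i(f)\<close>, \<open>L\<close> is the derivation \<open>D = u d/dX\<close> with
  \<open>u = L X\<close>, and \<open>u\<close> has the same order as \<open>f - X\<close>. The \<open>p\<close>-th power of \<open>D\<close> is again a derivation
  and equals \<open>c D\<close> for a series \<open>c\<close> with \<open>c' = 0\<close>. Hence passing from \<open>f\<close> to its \<open>p\<close>-th iterate
  multiplies \<open>u\<close> by \<open>c\<close> and replaces \<open>c\<close> by \<open>c\<^sup>p\<close> up to higher order, and all ramification
  numbers are governed by the order of the first \<open>c\<close>. Its coefficient at \<open>X\<^bsup>3p\<^esup>\<close> is, up to nonzero
  factors, the residue of \<open>dX / u\<close> and hence the given polynomial in the \<open>a\<^sub>i\<close>.
\<close>

section \<open>Operators raising the order of vanishing\<close>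

lemma fps_X_power_dvd_iff:
  fixes g :: "'a::comm_ring_1 fps"
  shows "fps_X ^ n dvd g \<longleftrightarrow> (\<forall>i<n. fps_nth g i = 0)"
proof
  assume "fps_X ^ n dvd g"
  then obtain h where "g = fps_X ^ n * h" by (rule dvdE)
  then show "\<forall>i<n. fps_nth g i = 0" by (simp add: fps_X_power_mult_nth)
next
  assume "\<forall>i<n. fps_nth g i = 0"
  then have "g = fps_X ^ n * fps_shift n g"
    by (intro fps_ext) (auto simp: fps_X_power_mult_nth)
  then show "fps_X ^ n dvd g" by (metis dvd_triv_left)
qed

lemma fps_X_power_dvd_mono:
  fixes g :: "'a::comm_ring_1 fps"
  assumes "fps_X ^ n dvd g" "m \<le> n"
  shows "fps_X ^ m dvd g"
  using assms by (meson dvd_trans le_imp_power_dvd)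

lemma fps_X_power_dvd_mult:
  fixes g h :: "'a::comm_ring_1 fps"
  assumes "fps_X ^ m dvd g" "fps_X ^ n dvd h"
  shows "fps_X ^ (m + n) dvd g * h"
  using assms by (simp add: power_add mult_dvd_mono)

lemma fps_X_power_dvd_deriv:
  fixes g :: "'a::comm_ring_1 fps"
  assumes "fps_X ^ Suc n dvd g"
  shows "fps_X ^ n dvd fps_deriv g"
  using assms by (auto simp: fps_X_power_dvd_iff simp del: power_Suc)

lemma fps_eq_0_if_all_powers_dvd:
  fixes g :: "'a::comm_ring_1 fps"
  assumes "\<And>n. fps_X ^ n dvd g"
  shows "g = 0"
  using assms by (intro fps_ext) (metis fps_X_power_dvd_iff fps_zero_nth lessI)

text \<open>An estimate relative to the order of the argument, in contrast to a fixed error term. In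
  this form the gains of composed operators add up.\<close>

definition raises :: "nat \<Rightarrow> ('a::comm_ring_1 fps \<Rightarrow> 'a fps) \<Rightarrow> bool" where
  "raises e A \<longleftrightarrow> (\<forall>n g. fps_X ^ n dvd g \<longrightarrow> fps_X ^ (n + e) dvd A g)"

text \<open>Only algebraic linearity. Infinite sums are handled by truncating and bounding the tail
  with \<open>raises\<close>.\<close>

definition fps_linear :: "('a::comm_ring_1 fps \<Rightarrow> 'a fps) \<Rightarrow> bool" where
  "fps_linear A \<longleftrightarrow> (\<forall>g h. A (g + h) = A g + A h) \<and> (\<forall>a g. A (fps_const a * g) = fps_const a * A g)"

lemma raisesD: "raises e A \<Longrightarrow> fps_X ^ n dvd g \<Longrightarrow> fps_X ^ (n + e) dvd A g"
  by (simp add: raises_def)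

lemma raises_funpow: "raises e A \<Longrightarrow> raises (k * e) (A ^^ k)"
proof (induction k)
  case (Suc k)
  then have "fps_X ^ (n + k * e + e) dvd A ((A ^^ k) g)" if "fps_X ^ n dvd g" for n g
    using that by (blast intro: raisesD)
  then show ?case
    by (simp add: raises_def algebra_simps)
qed (simp add: raises_def)

lemma fps_linear_add: "fps_linear A \<Longrightarrow> A (g + h) = A g + A h"
  and fps_linear_scale: "fps_linear A \<Longrightarrow> A (fps_const a * g) = fps_const a * A g"
  by (simp_all add: fps_linear_def)

lemma fps_linear_0: "fps_linear A \<Longrightarrow> A 0 = 0"
  using fps_linear_scale[of A 0 0] by simp

lemma fps_linear_uminus: "fps_linear A \<Longrightarrow> A (- g) = - A g"
  using fps_linear_add[of A g "- g"] fps_linear_0[of A] by (simp add: eq_neg_iff_add_eq_0 add.commute)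

lemma fps_linear_diff: "fps_linear A \<Longrightarrow> A (g - h) = A g - A h"
  using fps_linear_add[of A g "- h"] fps_linear_uminus[of A h] by simp

lemma fps_linear_sum: "fps_linear A \<Longrightarrow> A (sum G I) = (\<Sum>i\<in>I. A (G i))"
  by (induction I rule: infinite_finite_induct) (simp_all add: fps_linear_0 fps_linear_add)

lemma fps_linear_funpow: "fps_linear A \<Longrightarrow> fps_linear (A ^^ k)"
  by (induction k) (simp_all add: fps_linear_def)

text \<open>Telescoping: the next difference of powers is \<open>A\<close> applied to the previous
  difference plus \<open>A - B\<close> applied to a power of \<open>B\<close>. In every summand one
  factor gains \<open>e\<close> and the other \<open>k\<close> factors gain \<open>r\<close>
  each.\<close>

lemma raises_funpow_diff:
  fixes A B :: "'a::comm_ring_1 fps \<Rightarrow> 'a fps"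
  assumes A: "fps_linear A" "raises r A" and B: "raises r B"
    and AB: "raises e (\<lambda>g. A g - B g)"
  shows "raises (k * r + e) (\<lambda>g. (A ^^ Suc k) g - (B ^^ Suc k) g)"
proof (induction k)
  case (Suc k)
  show ?case
    unfolding raises_def
  proof (intro allI impI)
    fix n and g :: "'a fps"
    assume g: "fps_X ^ n dvd g"
    let ?a = "(A ^^ Suc k) g" and ?b = "(B ^^ Suc k) g"
    have "(A ^^ Suc (Suc k)) g - (B ^^ Suc (Suc k)) g = A (?a - ?b) + (A ?b - B ?b)"
      using A(1) by (simp add: fps_linear_diff)
    moreover have "fps_X ^ (n + (k * r + e) + r) dvd A (?a - ?b)"
      using A(2) Suc.IH g by (blast intro: raisesD[of _ "\<lambda>g. (A ^^ Suc k) g - (B ^^ Suc k) g"] raisesD[of _ A])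
    moreover have "fps_X ^ (n + Suc k * r + e) dvd A ?b - B ?b"
      using AB raises_funpow[OF B, of "Suc k"] g
      by (blast intro: raisesD[of _ "\<lambda>g. A g - B g"] raisesD[of _ "B ^^ Suc k"])
    moreover have "n + (k * r + e) + r = n + (Suc k * r + e)" "n + Suc k * r + e = n + (Suc k * r + e)"
      by simp_all
    ultimately show "fps_X ^ (n + (Suc k * r + e)) dvd (A ^^ Suc (Suc k)) g - (B ^^ Suc (Suc k)) g"
      by (metis dvd_add)
  qed
qed (use AB in simp)

text \<open>The error \<open>E = L - L(X) d/dX\<close> obeys the Leibniz rule up to relative order
  \<open>e\<close> and kills \<open>X\<close>. Induction makes it small on powers of
  \<open>X\<close>; linearity and truncation extend this to all series.\<close>

lemma near_derivation:
  fixes L :: "'a::comm_ring_1 fps \<Rightarrow> 'a fps"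
  assumes leibniz: "\<And>a b g h. fps_X ^ a dvd g \<Longrightarrow> fps_X ^ b dvd h \<Longrightarrow>
      fps_X ^ (a + b + e) dvd L (g * h) - L g * h - g * L h"
    and lin: "fps_linear L" and L: "raises 0 L"
  shows "raises e (\<lambda>g. L g - L fps_X * fps_deriv g)"
proof -
  define E where "E g = L g - L fps_X * fps_deriv g" for g
  have E_lin: "fps_linear E"
    using lin by (simp add: fps_linear_def E_def algebra_simps)
  have E_leibniz: "fps_X ^ (a + b + e) dvd E (g * h) - E g * h - g * E h"
    if "fps_X ^ a dvd g" "fps_X ^ b dvd h" for a b g h
  proof -
    have "E (g * h) - E g * h - g * E h = L (g * h) - L g * h - g * L h"
      by (simp add: E_def algebra_simps)
    then show ?thesis using leibniz[OF that] by simp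
  qed
  \<comment> \<open>With \<open>g = h = 1\<close> the Leibniz defect is
    \<open>E 1 - 2 E 1 = - E 1\<close>.\<close>
  have E1: "fps_X ^ e dvd E 1"
    using E_leibniz[of 0 1 0 1] by (simp add: dvd_minus_iff)
  have EX: "E fps_X = 0" by (simp add: E_def)
  have Epow: "fps_X ^ (n + e) dvd E (fps_X ^ n)" for n
  proof (induction n)
    case (Suc n)
    have "fps_X ^ (1 + n + e) dvd E (fps_X * fps_X ^ n) - E fps_X * fps_X ^ n - fps_X * E (fps_X ^ n)"
      by (rule E_leibniz) simp_all
    then have "fps_X ^ (Suc n + e) dvd E (fps_X ^ Suc n) - fps_X * E (fps_X ^ n)"
      by (simp add: EX)
    moreover have "fps_X ^ (Suc n + e) dvd fps_X * E (fps_X ^ n)"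
      using Suc.IH by (simp add: mult_dvd_mono)
    ultimately show ?case by (metis diff_add_cancel dvd_add)
  qed (use E1 in simp)
  have "fps_X ^ (n + e) dvd E g" if g: "fps_X ^ n dvd g" for n g
  proof -
    \<comment> \<open>Differentiating the tail costs one order, so the truncation goes one beyond
      \<open>n + e\<close>.\<close>
    define N where "N = Suc (n + e)"
    define t where "t = (\<Sum>i\<in>{n..<N}. fps_const (fps_nth g i) * fps_X ^ i)"
    have "fps_X ^ N dvd g - t"
    proof (unfold fps_X_power_dvd_iff, intro allI impI)
      fix i assume "i < N"
      have "fps_nth t i = (\<Sum>j\<in>{n..<N}. if j = i then fps_nth g i else 0)"
        unfolding t_def fps_sum_nth by (intro sum.cong) (auto simp: fps_X_power_nth)
      also have "\<dots> = fps_nth g i"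
        using \<open>i < N\<close> g by (auto simp: sum.delta fps_X_power_dvd_iff)
      finally show "fps_nth (g - t) i = 0" by simp
    qed
    have "fps_X ^ (n + e) dvd E (g - t)"
    proof -
      have "fps_X ^ N dvd L (g - t)"
        using raisesD[OF L \<open>fps_X ^ N dvd g - t\<close>] by simp
      moreover have "fps_X ^ (n + e) dvd L fps_X * fps_deriv (g - t)"
        using \<open>fps_X ^ N dvd g - t\<close> unfolding N_def by (intro dvd_mult fps_X_power_dvd_deriv)
      ultimately show ?thesis
        unfolding E_def by (intro dvd_diff) (auto simp: N_def intro: fps_X_power_dvd_mono)
    qed
    moreover have "fps_X ^ (n + e) dvd E t"
      unfolding t_def fps_linear_sum[OF E_lin] fps_linear_scale[OF E_lin]
    proof (intro dvd_sum dvd_mult)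
      fix i assume "i \<in> {n..<N}"
      then show "fps_X ^ (n + e) dvd E (fps_X ^ i)"
        using Epow[of i] by (auto intro: fps_X_power_dvd_mono)
    qed
    moreover have "E g = E (g - t) + E t"
      using fps_linear_add[OF E_lin, of "g - t" t] by simp
    ultimately show ?thesis by (metis dvd_add)
  qed
  then show ?thesis by (simp add: raises_def E_def)
qed

section \<open>Powers of a derivation in characteristic \<open>p\<close>\<close>

lemma funpow_leibniz:
  fixes D :: "'a::comm_ring_1 fps \<Rightarrow> 'a fps"
  assumes lin: "fps_linear D" and D: "\<And>g h. D (g * h) = D g * h + g * D h"
  shows "(D ^^ n) (g * h) = (\<Sum>k\<le>n. of_nat (n choose k) * (D ^^ k) g * (D ^^ (n - k)) h)"
proof (induction n)
  case (Suc n)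
  have scale: "D (of_nat m * x) = of_nat m * D x" for m x
    using fps_linear_scale[OF lin, of "of_nat m" x] by (simp add: fps_of_nat)
  have "(D ^^ Suc n) (g * h) = (\<Sum>k\<le>n. D (of_nat (n choose k) * ((D ^^ k) g * (D ^^ (n - k)) h)))"
    by (simp add: Suc.IH fps_linear_sum[OF lin] mult.assoc)
  also have "\<dots> = (\<Sum>k\<le>n. of_nat (n choose k) * D ((D ^^ k) g * (D ^^ (n - k)) h))"
    by (simp only: scale)
  also have "\<dots> = (\<Sum>k\<le>n. of_nat (n choose k) * (D ^^ Suc k) g * (D ^^ (n - k)) h)
      + (\<Sum>k\<le>n. of_nat (n choose k) * (D ^^ k) g * (D ^^ (Suc n - k)) h)"
    unfolding D sum.distrib[symmetric]
    by (intro sum.cong) (simp_all add: Suc_diff_le algebra_simps)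
  also have "(\<Sum>k\<le>n. of_nat (n choose k) * (D ^^ k) g * (D ^^ (Suc n - k)) h)
      = (\<Sum>k\<le>Suc n. of_nat (n choose k) * (D ^^ k) g * (D ^^ (Suc n - k)) h)"
    by (simp add: binomial_eq_0)
  also have "\<dots> = g * (D ^^ Suc n) h
      + (\<Sum>k\<le>n. of_nat (n choose Suc k) * (D ^^ Suc k) g * (D ^^ (n - k)) h)"
    by (subst sum.atMost_Suc_shift) simp
  also have "(\<Sum>k\<le>n. of_nat (n choose k) * (D ^^ Suc k) g * (D ^^ (n - k)) h) + (g * (D ^^ Suc n) h
      + (\<Sum>k\<le>n. of_nat (n choose Suc k) * (D ^^ Suc k) g * (D ^^ (n - k)) h))
    = g * (D ^^ Suc n) h + (\<Sum>k\<le>n. of_nat (Suc n choose Suc k) * (D ^^ Suc k) g * (D ^^ (n - k)) h)"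
    by (simp add: sum.distrib algebra_simps)
  also have "\<dots> = (\<Sum>k\<le>Suc n. of_nat (Suc n choose k) * (D ^^ k) g * (D ^^ (Suc n - k)) h)"
    by (subst sum.atMost_Suc_shift) simp
  finally show ?case .
qed simp

lemma of_nat_choose_card_eq_0:
  assumes "0 < k" "k < CARD('p::prime_card)"
  shows "(of_nat (CARD('p) choose k) :: 'p mod_ring) = 0"
proof -
  have "CARD('p) dvd (CARD('p) choose k)"
    using assms prime_card[where 'a = 'p] by (auto intro: dvd_choose_prime)
  then show ?thesis
    by (metis of_nat_card_eq_0 dvdE mult_zero_left of_nat_mult)
qed

definition vfield :: "'a::comm_ring_1 fps \<Rightarrow> 'a fps \<Rightarrow> 'a fps" where
  "vfield u g = u * fps_deriv g"

lemma vfield_linear: "fps_linear (vfield u)"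
  by (simp add: fps_linear_def vfield_def algebra_simps)

lemma vfield_mult: "vfield u (g * h) = vfield u g * h + g * vfield u h"
  by (simp add: vfield_def algebra_simps)

lemma vfield_mult_constant: "fps_deriv c = 0 \<Longrightarrow> vfield u (c * g) = c * vfield u g"
  by (simp add: vfield_def)

lemma vfield_funpow_mult_constant: "fps_deriv c = 0 \<Longrightarrow> (vfield u ^^ k) (c * g) = c * (vfield u ^^ k) g"
  by (induction k) (simp_all add: vfield_mult_constant)

lemma raises_vfield:
  assumes "fps_X ^ Suc r dvd u"
  shows "raises r (vfield u)"
  unfolding raises_def vfield_def
proof (intro allI impI)
  fix n and g :: "'a fps"
  assume g: "fps_X ^ n dvd g"
  show "fps_X ^ (n + r) dvd u * fps_deriv g"
  proof (cases n)
    case 0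
    then show ?thesis using assms by (simp add: dvd_mult2 dvd_trans[OF _ assms])
  next
    case (Suc m)
    with g have "fps_X ^ m dvd fps_deriv g" by (simp add: fps_X_power_dvd_deriv)
    from fps_X_power_dvd_mult[OF assms this] show ?thesis
      using Suc by (simp add: add.commute)
  qed
qed

text \<open>All inner binomial coefficients of \<open>p\<close> vanish in characteristic
  \<open>p\<close>, so only the two outer terms remain.\<close>

lemma vfield_power_card_leibniz:
  fixes u :: "'p::prime_card mod_ring fps"
  defines "D \<equiv> vfield u ^^ CARD('p)"
  shows "D (g * h) = D g * h + g * D h"
proof -
  let ?p = "CARD('p)"
  let ?F = "\<lambda>k. of_nat (?p choose k) * (vfield u ^^ k) g * (vfield u ^^ (?p - k)) h"
  have p: "0 < ?p" by simp
  have "D (g * h) = (\<Sum>k\<le>?p. ?F k)"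
    unfolding D_def by (intro funpow_leibniz vfield_linear vfield_mult)
  also have "\<dots> = (\<Sum>k\<in>{0, ?p}. ?F k)"
  proof (intro sum.mono_neutral_right)
    show "\<forall>k\<in>{..?p} - {0, ?p}. ?F k = 0"
      by (auto simp: of_nat_choose_card_eq_0 simp flip: fps_of_nat)
  qed auto
  also have "\<dots> = D g * h + g * D h" by (simp add: D_def)
  finally show ?thesis .
qed

text \<open>The Leibniz rule for the \<open>p\<close>-th power is exact, so
  \<open>near_derivation\<close> applies for every \<open>e\<close> and the error is divisible by
  all powers of \<open>X\<close>. The zero constant term of \<open>u\<close> guarantees that orders
  of vanishing do not drop.\<close>

lemma vfield_power_card:
  fixes u :: "'p::prime_card mod_ring fps"
  assumes "fps_nth u 0 = 0"
  shows "(vfield u ^^ CARD('p)) g = (vfield u ^^ CARD('p)) fps_X * fps_deriv g"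
proof -
  let ?D = "vfield u ^^ CARD('p)"
  have "raises e (\<lambda>g. ?D g - ?D fps_X * fps_deriv g)" for e
  proof (rule near_derivation)
    show "fps_linear ?D" by (intro fps_linear_funpow vfield_linear)
    have "raises 0 (vfield u)"
      using assms raises_vfield[of 0 u] fps_X_power_dvd_iff[of 1 u] by simp
    then show "raises 0 ?D" using raises_funpow[of 0 "vfield u" "CARD('p)"] by simp
  qed (simp add: vfield_power_card_leibniz)
  then have "fps_X ^ e dvd ?D g - ?D fps_X * fps_deriv g" for e
    using raisesD[of e _ 0 g] by force
  then have "?D g - ?D fps_X * fps_deriv g = 0" by (rule fps_eq_0_if_all_powers_dvd)
  then show ?thesis by simp
qed

section \<open>Polynomials in the composition operator\<close>

lemma fps_iterate_0 [simp]: "fps_iterate f 0 = fps_X"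
  and fps_iterate_Suc: "fps_iterate f (Suc m) = f oo fps_iterate f m"
  by (simp_all add: fps_iterate_def)

lemma fps_iterate_nth_0 [simp]: "fps_nth f 0 = 0 \<Longrightarrow> fps_nth (fps_iterate f m) 0 = 0"
  by (induction m) (simp_all add: fps_iterate_Suc)

lemma fps_iterate_1: "fps_nth f 0 = 0 \<Longrightarrow> fps_iterate f (Suc 0) = f"
  by (simp add: fps_iterate_Suc)

lemma fps_iterate_add:
  fixes f :: "'a::idom fps"
  assumes "fps_nth f 0 = 0"
  shows "fps_iterate f (m + n) = fps_iterate f m oo fps_iterate f n"
  using assms by (induction m) (simp_all add: fps_iterate_Suc fps_compose_assoc)

lemma fps_iterate_mult:
  fixes f :: "'a::idom fps"
  assumes "fps_nth f 0 = 0"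
  shows "fps_iterate f (m * n) = fps_iterate (fps_iterate f m) n"
  using assms by (induction n) (simp_all add: fps_iterate_Suc fps_iterate_add)

lemma compose_fps_iterate_Suc:
  fixes f :: "'a::idom fps"
  assumes "fps_nth f 0 = 0"
  shows "g oo fps_iterate f (Suc m) = (g oo f) oo fps_iterate f m"
  using assms by (simp add: fps_iterate_Suc fps_compose_assoc)

lemma compose_scale:
  fixes f :: "'a::idom fps"
  assumes "fps_nth f 0 = 0"
  shows "(fps_const a * g) oo f = fps_const a * (g oo f)"
  using assms by (simp add: fps_compose_mult_distrib)

text \<open>Turns power series into a module over the polynomial ring, the indeterminate acting as
  composition with \<open>f\<close>. Operator identities then follow from polynomial
  identities.\<close>

definition act :: "'a::comm_ring_1 fps \<Rightarrow> 'a poly \<Rightarrow> 'a fps \<Rightarrow> 'a fps" where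
  "act f P g = (\<Sum>i\<le>degree P. fps_const (coeff P i) * (g oo fps_iterate f i))"

context
  fixes f :: "'a::idom fps"
  assumes f0: "fps_nth f 0 = 0"
begin

lemma act_0 [simp]: "act f 0 g = 0"
  by (simp add: act_def)

lemma act_pCons: "act f (pCons a P) g = fps_const a * g + act f P (g oo f)"
proof (cases "P = 0")
  case False
  then show ?thesis
    by (simp add: act_def sum.atMost_Suc_shift compose_fps_iterate_Suc[OF f0] del: sum.atMost_Suc)
qed (simp add: act_def)

lemma act_add: "act f (P + Q) g = act f P g + act f Q g"
  by (induction P Q arbitrary: g rule: poly_induct2) (simp_all add: act_pCons algebra_simps flip: fps_const_add)

lemma act_smult: "act f (smult a P) g = fps_const a * act f P g"
  by (induction P arbitrary: g) (simp_all add: act_pCons algebra_simps flip: fps_const_mult)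

lemma act_uminus: "act f (- P) g = - act f P g"
  using act_smult[of "- 1" P g] by (simp flip: fps_const_neg)

lemma act_sum: "act f (sum P I) g = (\<Sum>i\<in>I. act f (P i) g)"
  by (induction I rule: infinite_finite_induct) (simp_all add: act_add)

lemma act_linear: "fps_linear (act f P)"
proof -
  have "act f P (g + h) = act f P g + act f P h" for g h
    by (simp add: act_def fps_compose_add_distrib algebra_simps sum.distrib)
  moreover have "act f P (fps_const a * g) = fps_const a * act f P g" for a g
    using f0 by (simp add: act_def compose_scale sum_distrib_left mult.left_commute)
  ultimately show ?thesis by (simp add: fps_linear_def)
qed

lemma act_compose: "act f P (g oo f) = act f P g oo f"
proof -
  have "(g oo f) oo fps_iterate f i = (g oo fps_iterate f i) oo f" for i
    using fps_iterate_add[OF f0, of i 1] compose_fps_iterate_Suc[OF f0, of g i] f0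
    by (simp add: fps_iterate_1 fps_compose_assoc)
  then show ?thesis
    using f0 by (simp add: act_def fps_compose_sum_distrib compose_scale)
qed

lemma act_mult: "act f (P * Q) g = act f P (act f Q g)"
  by (induction P arbitrary: g) (simp_all add: act_pCons act_add act_smult act_compose)

lemma act_1: "act f 1 g = g"
  by (simp add: act_def)

lemma act_power: "act f (P ^ n) g = (act f P ^^ n) g"
  by (induction n arbitrary: g) (simp_all add: act_1 act_mult)

lemma act_monom: "act f (monom a m) g = fps_const a * (g oo fps_iterate f m)"
proof (cases "a = 0")
  case False
  then have "act f (monom a m) g = (\<Sum>i\<in>{m}. fps_const (coeff (monom a m) i) * (g oo fps_iterate f i))"
    unfolding act_def by (intro sum.mono_neutral_cong) (auto simp: degree_monom_eq coeff_monom)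
  then show ?thesis by simp
qed simp

lemma act_diff_operator: "act f [:- 1, 1:] g = (g oo f) - g"
  by (simp add: act_pCons flip: fps_const_neg)

end

text \<open>By induction \<open>f ^ i\<close> and \<open>X ^ i\<close> agree below order
  \<open>i + r\<close>; the coefficient formula for composition transfers this to all
  series.\<close>

lemma raises_compose_diff:
  fixes f :: "'a::idom fps"
  assumes "fps_nth f 0 = 0" "fps_X ^ Suc r dvd f - fps_X"
  shows "raises r (\<lambda>g. (g oo f) - g)"
  unfolding raises_def
proof (intro allI impI)
  fix n and g :: "'a fps"
  assume g: "fps_X ^ n dvd g"
  have f1: "fps_X ^ 1 dvd f"
    using assms(1) by (subst fps_X_power_dvd_iff) simp
  have pow: "fps_X ^ (i + r) dvd f ^ i - fps_X ^ i" for i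
  proof (induction i)
    case (Suc i)
    have "f ^ Suc i - fps_X ^ Suc i = f * (f ^ i - fps_X ^ i) + (f - fps_X) * fps_X ^ i"
      by (simp add: algebra_simps)
    moreover have "fps_X ^ (1 + (i + r)) dvd f * (f ^ i - fps_X ^ i)"
      using f1 Suc.IH by (rule fps_X_power_dvd_mult)
    moreover have "fps_X ^ (Suc r + i) dvd (f - fps_X) * fps_X ^ i"
      using assms(2) by (intro fps_X_power_dvd_mult) simp_all
    ultimately show ?case
      by (metis (no_types, lifting) add.commute add_Suc dvd_add plus_1_eq_Suc)
  qed simp
  show "fps_X ^ (n + r) dvd (g oo f) - g"
  proof (unfold fps_X_power_dvd_iff, intro allI impI)
    fix j assume j: "j < n + r"
    have "(g oo f) - g = (g oo f) - (g oo fps_X)" by simp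
    then have "fps_nth ((g oo f) - g) j = (\<Sum>i=0..j. fps_nth g i * fps_nth (f ^ i - fps_X ^ i) j)"
      by (simp only: fps_compose_nth fps_sub_nth sum_subtractf right_diff_distrib)
    also have "\<dots> = 0"
    proof (intro sum.neutral ballI)
      fix i
      show "fps_nth g i * fps_nth (f ^ i - fps_X ^ i) j = 0"
      proof (cases "i < n")
        case True
        then show ?thesis using g by (simp add: fps_X_power_dvd_iff)
      next
        case False
        then show ?thesis using pow[of i] j by (simp add: fps_X_power_dvd_iff)
      qed
    qed
    finally show "fps_nth ((g oo f) - g) j = 0" .
  qed
qed

section \<open>The truncated logarithm\<close>

lemma of_nat_mod_ring_eq_0_iff: "(of_nat n :: 'p::prime_card mod_ring) = 0 \<longleftrightarrow> CARD('p) dvd n"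
  using of_nat_0_mod_ring_dvd[of n, where 'a = 'p] by (metis dvdE mult_zero_left of_nat_card_eq_0 of_nat_mult)

lemma of_nat_mod_ring_neq_0: "0 < n \<Longrightarrow> n < CARD('p) \<Longrightarrow> (of_nat n :: 'p::prime_card mod_ring) \<noteq> 0"
  by (auto simp: of_nat_mod_ring_eq_0_iff dest: dvd_imp_le)

text \<open>The polynomial \<open>\<Sum>\<^bsub>0<k<p\<^esub> (-1)\<^bsup>k-1\<^esup> (t - 1)\<^bsup>k\<^esup> / k\<close>, written in powers of \<open>t\<close>.\<close>

definition log_poly :: "'p::prime_card mod_ring poly" where
  "log_poly = - (\<Sum>m\<in>{1..<CARD('p)}. monom (inverse (of_nat m)) m)"

definition trunc_log :: "'p::prime_card mod_ring fps \<Rightarrow> 'p mod_ring fps \<Rightarrow> 'p mod_ring fps" where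
  "trunc_log f = act f log_poly"

lemma trunc_log_eq:
  fixes f :: "'p::prime_card mod_ring fps"
  assumes "fps_nth f 0 = 0"
  shows "trunc_log f g = - (\<Sum>m\<in>{1..<CARD('p)}. fps_const (inverse (of_nat m)) * (g oo fps_iterate f m))"
  using assms by (simp add: trunc_log_def log_poly_def act_uminus act_sum act_monom)

lemma mod_ring_power_card: "(x :: 'p::prime_card mod_ring) ^ CARD('p) = x"
  using finite_field_power_card_eq_same[of x] by simp

text \<open>Frobenius is additive and fixes the coefficients, which lie in the prime field. Hence
  \<open>log_poly ^ p\<close> is \<open>log_poly\<close> with \<open>t\<close> replaced by
  \<open>t ^ p\<close>, and \<open>t ^ p\<close> acts as composition with the \<open>p\<close>-th
  iterate.\<close>

lemma trunc_log_power_card: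
  fixes f :: "'p::prime_card mod_ring fps"
  assumes "fps_nth f 0 = 0"
  shows "(trunc_log f ^^ CARD('p)) g = trunc_log (fps_iterate f CARD('p)) g"
proof -
  let ?p = "CARD('p)"
  have p: "prime ?p" by (rule prime_card)
  have "(- 1 :: 'p mod_ring poly) ^ ?p = - 1"
  proof -
    have "[:(- 1 :: 'p mod_ring):] ^ ?p = [:(- 1) ^ ?p:]" by (simp add: poly_const_pow)
    then show ?thesis by (simp only: mod_ring_power_card) (simp add: one_pCons)
  qed
  then have "(log_poly :: 'p mod_ring poly) ^ ?p
      = - ((\<Sum>m\<in>{1..<?p}. monom (inverse (of_nat m)) m) ^ ?p)"
    unfolding log_poly_def by (subst power_minus) simp
  also have "\<dots> = - (\<Sum>m\<in>{1..<?p}. monom (inverse (of_nat m)) m ^ ?p)"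
    using p by (subst freshmans_dream_sum) simp_all
  also have "\<dots> = - (\<Sum>m\<in>{1..<?p}. monom (inverse (of_nat m)) (?p * m))"
    by (simp add: monom_power mod_ring_power_card mult.commute)
  finally have *: "(log_poly :: 'p mod_ring poly) ^ ?p = \<dots>" .
  have "(trunc_log f ^^ ?p) g = act f (log_poly ^ ?p) g"
    using assms by (simp add: trunc_log_def act_power)
  also have "\<dots> = trunc_log (fps_iterate f ?p) g"
    using assms unfolding *
    by (simp add: trunc_log_eq act_uminus act_sum act_monom fps_iterate_mult)
  finally show ?thesis .
qed

section \<open>Power sums over the prime field\<close>

lemma bij_of_nat_mod_ring: "bij_betw of_nat {..<CARD('p)} (UNIV :: 'p::prime_card mod_ring set)"
proof -
  have "of_nat ` {..<CARD('p)} = (UNIV :: 'p mod_ring set)"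
    using surj_of_nat_mod_ring[where 'a = 'p] by blast
  then show ?thesis
    by (simp add: bij_betw_def eq_card_imp_inj_on)
qed

text \<open>For \<open>s > 0\<close> the polynomial \<open>t ^ s - 1\<close> has fewer than
  \<open>p - 1\<close> roots, so some \<open>a \<noteq> 0\<close> has
  \<open>a ^ s \<noteq> 1\<close>. Multiplication by \<open>a\<close> permutes the field and scales
  the sum by \<open>a ^ s\<close>, which forces it to vanish.\<close>

lemma sum_mod_ring_power_eq_0:
  assumes "s < CARD('p::prime_card) - 1"
  shows "(\<Sum>x\<in>UNIV. (x :: 'p mod_ring) ^ s) = 0"
proof (cases "s = 0")
  case False
  let ?Q = "monom 1 s - 1 :: 'p mod_ring poly"
  have "poly ?Q 0 \<noteq> 0"
    using False by (simp add: poly_monom power_0_left)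
  then have "?Q \<noteq> 0" by auto
  have "card {x. poly ?Q x = 0} \<le> degree ?Q"
    using \<open>?Q \<noteq> 0\<close> by (rule card_poly_roots_bound)
  also have "\<dots> \<le> s"
    by (intro degree_diff_le) (simp_all add: degree_monom_le)
  also have "\<dots> < card (UNIV - {0 :: 'p mod_ring})"
    using assms by (simp add: card_Diff_singleton)
  finally have "\<not> UNIV - {0} \<subseteq> {x. poly ?Q x = 0}"
    by (meson card_mono finite leD)
  then obtain a :: "'p mod_ring" where a: "a \<noteq> 0" "a ^ s \<noteq> 1"
    by (auto simp: poly_monom)
  have "bij ((*) a)"
    using a(1) by (intro bij_betw_byWitness[where f' = "\<lambda>x. x / a"]) auto
  then have "(\<Sum>x\<in>UNIV. x ^ s) = (\<Sum>x\<in>UNIV. (a * x) ^ s)"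
    by (rule sum.reindex_bij_betw[symmetric])
  also have "\<dots> = a ^ s * (\<Sum>x\<in>UNIV. x ^ s)"
    by (simp add: power_mult_distrib sum_distrib_left)
  finally show ?thesis using a(2) by simp
qed (use of_nat_card_eq_0[where 'a = 'p] in simp)

lemma sum_poly_mod_ring_eq_0:
  fixes Q :: "'p::prime_card mod_ring poly"
  assumes "degree Q < CARD('p) - 1"
  shows "(\<Sum>m<CARD('p). poly Q (of_nat m)) = 0"
proof -
  have "(\<Sum>m<CARD('p). poly Q (of_nat m)) = (\<Sum>x\<in>UNIV. poly Q x)"
    by (rule sum.reindex_bij_betw[OF bij_of_nat_mod_ring])
  also have "\<dots> = (\<Sum>i\<le>degree Q. coeff Q i * (\<Sum>x\<in>UNIV. x ^ i))"
    unfolding poly_altdef sum_distrib_left by (rule sum.swap)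
  also have "\<dots> = 0"
    using assms by (intro sum.neutral) (auto simp: sum_mod_ring_power_eq_0)
  finally show ?thesis .
qed

lemma poly_falling_factorial:
  "poly (\<Prod>i<k. [:- of_nat i, 1:]) (of_nat m :: 'a::comm_ring_1) = of_nat (fact k) * of_nat (m choose k)"
proof (induction k)
  case (Suc k)
  have absorb: "Suc k * (m choose Suc k) = (m - k) * (m choose k)"
    using binomial_absorption[of k "m"] binomial_absorb_comp[of m k] by simp
  have "(of_nat m - of_nat k :: 'a) * of_nat (m choose k) = of_nat ((m - k) * (m choose k))"
    by (cases "k \<le> m") (simp_all add: of_nat_diff binomial_eq_0)
  also have "\<dots> = of_nat (Suc k) * of_nat (m choose Suc k)"
    by (metis absorb of_nat_mult)
  finally have step: "(of_nat m - of_nat k :: 'a) * of_nat (m choose k) = of_nat (Suc k) * of_nat (m choose Suc k)" .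
  have "poly (\<Prod>i<Suc k. [:- of_nat i, 1:]) (of_nat m :: 'a)
      = of_nat (fact k) * ((of_nat m - of_nat k) * of_nat (m choose k))"
    using Suc.IH by (simp add: algebra_simps)
  also have "\<dots> = of_nat (fact (Suc k)) * of_nat (m choose Suc k)"
    unfolding step fact_Suc by (simp add: algebra_simps del: binomial_Suc_Suc)
  finally show ?case .
qed simp

lemma of_nat_fact_mod_ring_neq_0:
  assumes "k < CARD('p::prime_card)"
  shows "(of_nat (fact k) :: 'p mod_ring) \<noteq> 0"
  using assms prime_card[where 'a = 'p]
  by (simp add: of_nat_mod_ring_eq_0_iff prime_dvd_fact_iff del: of_nat_fact)

text \<open>Up to the invertible factor \<open>k! l!\<close>, the summand is a polynomial in
  \<open>m\<close> of degree \<open>k + l - 1 < p - 1\<close>, since \<open>1/m\<close> cancels one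
  of the two factors \<open>m\<close>. This removes the low-order part of the Leibniz defect of the
  truncated logarithm.\<close>

lemma sum_inverse_choose_choose_eq_0:
  assumes "0 < k" "0 < l" "k + l < CARD('p::prime_card)"
  shows "(\<Sum>m\<in>{1..<CARD('p)}. inverse (of_nat m) * of_nat (m choose k) * of_nat (m choose l)) = (0 :: 'p mod_ring)"
proof -
  let ?p = "CARD('p)"
  \<comment> \<open>The falling factorial of length \<open>k\<close> with its factor
    \<open>m\<close> removed.\<close>
  define B :: "nat \<Rightarrow> 'p mod_ring poly" where "B k = (\<Prod>i\<in>{1..<k}. [:- of_nat i, 1:])" for k
  have B_deg: "degree (B k) \<le> k - 1" for k
  proof -
    have "degree (B k) \<le> (\<Sum>i\<in>{1..<k}. degree [:- of_nat i, 1 :: 'p mod_ring:])"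
      using degree_prod_sum_le[of "{1..<k}" "\<lambda>i. [:- of_nat i, 1 :: 'p mod_ring:]"] by (simp add: B_def o_def)
    then show ?thesis by simp
  qed
  have B_poly: "of_nat m * poly (B k) (of_nat m) = of_nat (fact k) * of_nat (m choose k)" if "0 < k" for k m
  proof -
    have "{..<k} = insert 0 {1..<k}" using that by auto
    then have "poly (\<Prod>i<k. [:- of_nat i, 1:]) (of_nat m) = of_nat m * poly (B k) (of_nat m)"
      by (simp add: B_def)
    then show ?thesis by (simp only: poly_falling_factorial)
  qed
  have "of_nat (fact k) * of_nat (fact l) *
      (\<Sum>m\<in>{1..<?p}. inverse (of_nat m) * of_nat (m choose k) * of_nat (m choose l))
    = (\<Sum>m\<in>{1..<?p}. inverse (of_nat m :: 'p mod_ring) *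
        (of_nat (fact k) * of_nat (m choose k)) * (of_nat (fact l) * of_nat (m choose l)))"
    unfolding sum_distrib_left by (intro sum.cong) (simp_all only: mult_ac)
  also have "\<dots> = (\<Sum>m\<in>{1..<?p}. poly ([:0, 1:] * B k * B l) (of_nat m))"
  proof (intro sum.cong refl)
    fix m assume "m \<in> {1..<?p}"
    then have "(of_nat m :: 'p mod_ring) \<noteq> 0" by (intro of_nat_mod_ring_neq_0) auto
    then show "inverse (of_nat m :: 'p mod_ring) *
        (of_nat (fact k) * of_nat (m choose k)) * (of_nat (fact l) * of_nat (m choose l))
      = poly ([:0, 1:] * B k * B l) (of_nat m)"
      using assms by (simp flip: B_poly)
  qed
  \<comment> \<open>The remaining factor \<open>m\<close> makes the added term at
    \<open>m = 0\<close> vanish.\<close>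
  also have "\<dots> = (\<Sum>m<?p. poly ([:0, 1:] * B k * B l) (of_nat m))"
    by (intro sum.mono_neutral_left) (auto simp: not_less_eq_eq)
  also have "\<dots> = 0"
  proof (rule sum_poly_mod_ring_eq_0)
    have "degree ([:0, 1:] * B k * B l) \<le> 1 + (k - 1) + (l - 1)"
      using B_deg[of k] B_deg[of l]
      by (intro order.trans[OF degree_mult_le] add_mono) simp_all
    then show "degree ([:0, 1:] * B k * B l) < ?p - 1" using assms by linarith
  qed
  finally have z: "of_nat (fact k) * of_nat (fact l) *
      (\<Sum>m\<in>{1..<?p}. inverse (of_nat m) * of_nat (m choose k) * of_nat (m choose l)) = (0 :: 'p mod_ring)" .
  have "of_nat (fact k) * of_nat (fact l) \<noteq> (0 :: 'p mod_ring)"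
    using assms of_nat_fact_mod_ring_neq_0[of k, where 'p = 'p] of_nat_fact_mod_ring_neq_0[of l, where 'p = 'p]
    by (simp del: of_nat_fact)
  with z show ?thesis by (simp only: mult_eq_0_iff) simp
qed

text \<open>By Fermat \<open>1/m = m ^ (p - 2)\<close>, a power sum of exponent below
  \<open>p - 1\<close>; for \<open>p > 2\<close> the term at 0 contributes nothing.\<close>

lemma sum_inverse_mod_ring_eq_0:
  assumes "CARD('p::prime_card) > 2"
  shows "(\<Sum>m\<in>{1..<CARD('p)}. inverse (of_nat m)) = (0 :: 'p mod_ring)"
proof -
  let ?p = "CARD('p)"
  have "(\<Sum>m\<in>{1..<?p}. inverse (of_nat m)) = (\<Sum>m\<in>{1..<?p}. poly (monom 1 (?p - 2)) (of_nat m :: 'p mod_ring))"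
  proof (intro sum.cong refl)
    fix m assume "m \<in> {1..<?p}"
    then have m: "(of_nat m :: 'p mod_ring) \<noteq> 0" by (intro of_nat_mod_ring_neq_0) auto
    have "of_nat m ^ ?p = of_nat m * of_nat m * (of_nat m :: 'p mod_ring) ^ (?p - 2)"
      using assms by (metis less_imp_le_nat le_add_diff_inverse power2_eq_square power_add)
    then have "of_nat m * (of_nat m :: 'p mod_ring) ^ (?p - 2) = 1"
      using m by (simp add: mod_ring_power_card)
    then show "inverse (of_nat m) = poly (monom 1 (?p - 2)) (of_nat m :: 'p mod_ring)"
      using m by (simp add: poly_monom field_simps)
  qed
  also have "\<dots> = (\<Sum>m<?p. poly (monom 1 (?p - 2)) (of_nat m))"
    using assms by (intro sum.mono_neutral_left) (auto simp: poly_monom not_less_eq_eq)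
  also have "\<dots> = 0"
    using assms by (intro sum_poly_mod_ring_eq_0) (simp add: degree_monom_eq)
  finally show ?thesis .
qed

text \<open>The coefficient of \<open>(t - 1) ^ k\<close> in \<open>log_poly\<close>, obtained by
  expanding each \<open>t ^ m\<close> binomially. Only \<open>k = 0, 1, 2\<close> need explicit
  values: 0, 1 and -1/2, as in the ordinary logarithm.\<close>

definition log_coeff :: "nat \<Rightarrow> 'p::prime_card mod_ring" where
  "log_coeff k = - (\<Sum>m\<in>{1..<CARD('p)}. inverse (of_nat m) * of_nat (m choose k))"

lemma log_coeff_0: "CARD('p::prime_card) > 2 \<Longrightarrow> (log_coeff 0 :: 'p mod_ring) = 0"
  by (simp add: log_coeff_def sum_inverse_mod_ring_eq_0[simplified])

lemma sum_inverse_mult: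
  "(\<Sum>m\<in>{1..<CARD('p)}. inverse (of_nat m) * (of_nat m * h m)) = (\<Sum>m\<in>{1..<CARD('p)}. h m :: 'p::prime_card mod_ring)"
proof (intro sum.cong refl)
  fix m assume "m \<in> {1..<CARD('p)}"
  then have "(of_nat m :: 'p mod_ring) \<noteq> 0" by (intro of_nat_mod_ring_neq_0) auto
  then show "inverse (of_nat m) * (of_nat m * h m) = h m" by simp
qed

lemma log_coeff_1: "(log_coeff 1 :: 'p::prime_card mod_ring) = 1"
proof -
  have "(log_coeff 1 :: 'p mod_ring) = - of_nat (CARD('p) - 1)"
    using sum_inverse_mult[of "\<lambda>_. 1 :: 'p mod_ring"] by (simp add: log_coeff_def)
  also have "\<dots> = 1"
    using of_nat_card_eq_0[where 'a = 'p] by (subst of_nat_diff) simp_all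
  finally show ?thesis .
qed

lemma log_coeff_2:
  assumes "CARD('p::prime_card) > 2"
  shows "2 * log_coeff 2 = (- 1 :: 'p mod_ring)"
proof -
  let ?p = "CARD('p)"
  have choose_2: "(of_nat (2 * (m choose 2)) :: 'p mod_ring) = of_nat m * (of_nat m - 1)" for m
    by (cases m) (simp_all add: choose_two algebra_simps)
  have "2 * log_coeff 2 = - (\<Sum>m\<in>{1..<?p}. inverse (of_nat m) * (of_nat (2 * (m choose 2)) :: 'p mod_ring))"
    by (simp add: log_coeff_def sum_distrib_left mult_ac)
  also have "\<dots> = - (\<Sum>m\<in>{1..<?p}. of_nat m - 1)"
    unfolding choose_2 sum_inverse_mult ..
  \<comment> \<open>Completing the sum adds the term -1 at \<open>m = 0\<close>, which the summand 1
    compensates.\<close>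
  also have "(\<Sum>m\<in>{1..<?p}. of_nat m - 1 :: 'p mod_ring) = 1 + (\<Sum>m<?p. poly [:- 1, 1:] (of_nat m))"
  proof -
    have "{..<?p} = insert 0 {1..<?p}" by auto
    then show ?thesis by (simp add: algebra_simps)
  qed
  also have "(\<Sum>m<?p. poly [:- 1, 1:] (of_nat m :: 'p mod_ring)) = 0"
    using assms by (intro sum_poly_mod_ring_eq_0) simp
  finally show ?thesis by simp
qed

lemma fps_const_sum: "fps_const (sum h I) = (\<Sum>i\<in>I. fps_const (h i :: 'a::comm_ring_1))"
  by (induction I rule: infinite_finite_induct) (simp_all flip: fps_const_add)

section \<open>The truncated logarithm as a polynomial in \<open>\<Delta> = T - 1\<close>\<close>

context
  fixes f :: "'p::prime_card mod_ring fps" and \<Delta> :: "'p mod_ring fps \<Rightarrow> 'p mod_ring fps"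
  assumes f0: "fps_nth f 0 = 0"
  defines "\<Delta> \<equiv> \<lambda>g. (g oo f) - g"
begin

text \<open>The binomial expansion of \<open>t ^ m = ((t - 1) + 1) ^ m\<close>. The range of
  \<open>k\<close> is made independent of \<open>m\<close> so that sums over \<open>m\<close> and
  \<open>k\<close> can be exchanged.\<close>

lemma compose_iterate_expansion:
  assumes "m < CARD('p)"
  shows "g oo fps_iterate f m = (\<Sum>k<CARD('p). of_nat (m choose k) * (\<Delta> ^^ k) g)"
proof -
  have \<Delta>: "\<Delta> = act f [:- 1, 1:]"
    using act_diff_operator[OF f0] by (simp add: \<Delta>_def fun_eq_iff)
  have "monom (1 :: 'p mod_ring) m = ([:- 1, 1:] + 1) ^ m"
    by (simp add: monom_altdef one_pCons)
  also have "\<dots> = (\<Sum>k\<le>m. smult (of_nat (m choose k)) ([:- 1, 1:] ^ k))"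
    by (subst binomial_ring) (simp add: of_nat_poly)
  finally have *: "monom (1 :: 'p mod_ring) m = \<dots>" .
  have "g oo fps_iterate f m = act f (monom 1 m) g"
    using f0 by (simp add: act_monom)
  also have "\<dots> = (\<Sum>k\<le>m. of_nat (m choose k) * (\<Delta> ^^ k) g)"
    using f0 unfolding * by (simp add: act_sum act_smult act_power \<Delta> fps_of_nat)
  also have "\<dots> = (\<Sum>k<CARD('p). of_nat (m choose k) * (\<Delta> ^^ k) g)"
    using assms by (intro sum.mono_neutral_left) (auto simp: binomial_eq_0)
  finally show ?thesis .
qed

lemma compose_iterate_diff_expansion:
  assumes "m < CARD('p)"
  shows "(g oo fps_iterate f m) - g = (\<Sum>k\<in>{1..<CARD('p)}. of_nat (m choose k) * (\<Delta> ^^ k) g)"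
proof -
  have "{..<CARD('p)} = insert 0 {1..<CARD('p)}" by auto
  then show ?thesis
    using assms by (simp add: compose_iterate_expansion)
qed

lemma trunc_log_expansion:
  assumes "CARD('p) > 2"
  shows "trunc_log f g = (\<Sum>k\<in>{1..<CARD('p)}. fps_const (log_coeff k) * (\<Delta> ^^ k) g)"
proof -
  let ?p = "CARD('p)"
  have "trunc_log f g = - (\<Sum>m\<in>{1..<?p}. \<Sum>k<?p. fps_const (inverse (of_nat m)) * (of_nat (m choose k) * (\<Delta> ^^ k) g))"
    by (simp add: trunc_log_eq[OF f0] compose_iterate_expansion sum_distrib_left)
  also have "\<dots> = - (\<Sum>k<?p. \<Sum>m\<in>{1..<?p}. fps_const (inverse (of_nat m)) * (of_nat (m choose k) * (\<Delta> ^^ k) g))"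
    by (subst sum.swap) simp
  also have "\<dots> = (\<Sum>k<?p. fps_const (log_coeff k) * (\<Delta> ^^ k) g)"
    by (simp add: log_coeff_def sum_distrib_right sum_negf mult.assoc fps_of_nat fps_const_sum
        flip: fps_const_mult fps_const_neg)
  also have "\<dots> = (\<Sum>k\<in>{1..<?p}. fps_const (log_coeff k) * (\<Delta> ^^ k) g)"
  proof -
    have "{..<?p} = insert 0 {1..<?p}" by auto
    then show ?thesis using assms by (simp add: log_coeff_0)
  qed
  finally show ?thesis .
qed

text \<open>Composition with an iterate is a ring endomorphism \<open>T\<close>, with Leibniz defect
  \<open>(T g - g) (T h - h) - g h\<close>. The terms \<open>g h\<close> cancel after weighting by
  \<open>1/m\<close>, because the reciprocals sum to zero.\<close>

lemma trunc_log_leibniz_defect: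
  assumes p: "CARD('p) > 2"
  shows "trunc_log f (g * h) - trunc_log f g * h - g * trunc_log f h =
    - (\<Sum>k\<in>{1..<CARD('p)}. \<Sum>l\<in>{1..<CARD('p)}.
        fps_const (\<Sum>m\<in>{1..<CARD('p)}. inverse (of_nat m) * of_nat (m choose k) * of_nat (m choose l))
        * (\<Delta> ^^ k) g * (\<Delta> ^^ l) h)"
proof -
  let ?p = "CARD('p)"
  let ?I = "{1..<?p}"
  let ?c = "\<lambda>m. fps_const (inverse (of_nat m :: 'p mod_ring))"
  let ?T = "\<lambda>m g. g oo fps_iterate f m"
  have c0: "(\<Sum>m\<in>?I. ?c m) = 0"
    using sum_inverse_mod_ring_eq_0[OF p] by (simp flip: fps_const_sum)
  have "trunc_log f (g * h) - trunc_log f g * h - g * trunc_log f h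
     = - (\<Sum>m\<in>?I. ?c m * (?T m g * ?T m h)) + (\<Sum>m\<in>?I. ?c m * ?T m g) * h
       + g * (\<Sum>m\<in>?I. ?c m * ?T m h) - (\<Sum>m\<in>?I. ?c m) * (g * h)"
    unfolding c0 using f0 by (simp add: trunc_log_eq fps_compose_mult_distrib)
  also have "\<dots> = - (\<Sum>m\<in>?I. ?c m * ((?T m g - g) * (?T m h - h)))"
    unfolding sum_distrib_right sum_distrib_left
    by (simp add: algebra_simps sum.distrib sum_subtractf)
  also have "(\<Sum>m\<in>?I. ?c m * ((?T m g - g) * (?T m h - h)))
    = (\<Sum>m\<in>?I. \<Sum>k\<in>?I. \<Sum>l\<in>?I. ?c m * (of_nat (m choose k) * (\<Delta> ^^ k) g * (of_nat (m choose l) * (\<Delta> ^^ l) h)))"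
  proof (intro sum.cong refl)
    fix m assume "m \<in> ?I"
    then have m: "m < ?p" by simp
    show "?c m * ((?T m g - g) * (?T m h - h))
      = (\<Sum>k\<in>?I. \<Sum>l\<in>?I. ?c m * (of_nat (m choose k) * (\<Delta> ^^ k) g * (of_nat (m choose l) * (\<Delta> ^^ l) h)))"
      unfolding compose_iterate_diff_expansion[OF m] sum_product
      unfolding sum_distrib_left ..
  qed
  also have "\<dots> = (\<Sum>k\<in>?I. \<Sum>l\<in>?I. \<Sum>m\<in>?I. ?c m * (of_nat (m choose k) * (\<Delta> ^^ k) g * (of_nat (m choose l) * (\<Delta> ^^ l) h)))"
    by (subst sum.swap) (intro sum.cong refl sum.swap)
  also have "\<dots> = (\<Sum>k\<in>?I. \<Sum>l\<in>?I.
        fps_const (\<Sum>m\<in>?I. inverse (of_nat m) * of_nat (m choose k) * of_nat (m choose l))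
        * (\<Delta> ^^ k) g * (\<Delta> ^^ l) h)"
    by (intro sum.cong refl)
      (simp add: sum_distrib_left mult_ac fps_of_nat fps_const_sum flip: fps_const_mult)
  finally show ?thesis .
qed

text \<open>In the double sum for the Leibniz defect, terms with \<open>k + l < p\<close> have
  coefficient zero, and those with \<open>k + l \<ge> p\<close> gain at least
  \<open>p * r\<close>.\<close>

lemma trunc_log_near_derivation:
  assumes p: "CARD('p) > 2" and r: "fps_X ^ Suc r dvd f - fps_X"
  shows "raises (CARD('p) * r) (\<lambda>g. trunc_log f g - vfield (trunc_log f fps_X) g)"
  unfolding vfield_def
proof (rule near_derivation)
  let ?p = "CARD('p)"
  have \<Delta>: "raises r \<Delta>" unfolding \<Delta>_def using f0 r by (rule raises_compose_diff)
  show "fps_linear (trunc_log f)"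
    unfolding trunc_log_def using f0 by (rule act_linear)
  show "raises 0 (trunc_log f)"
    unfolding raises_def trunc_log_expansion[OF p]
    by (auto intro!: dvd_sum dvd_mult intro: fps_X_power_dvd_mono[OF raisesD[OF raises_funpow[OF \<Delta>]]])
  fix a b and g h :: "'p mod_ring fps"
  assume g: "fps_X ^ a dvd g" and h: "fps_X ^ b dvd h"
  show "fps_X ^ (a + b + ?p * r) dvd trunc_log f (g * h) - trunc_log f g * h - g * trunc_log f h"
    unfolding trunc_log_leibniz_defect[OF p] dvd_minus_iff
  proof (intro dvd_sum)
    fix k l assume kl: "k \<in> {1..<?p}" "l \<in> {1..<?p}"
    show "fps_X ^ (a + b + ?p * r) dvd
        fps_const (\<Sum>m\<in>{1..<?p}. inverse (of_nat m) * of_nat (m choose k) * of_nat (m choose l))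
        * (\<Delta> ^^ k) g * (\<Delta> ^^ l) h"
    proof (cases "k + l < ?p")
      case True
      then show ?thesis using kl sum_inverse_choose_choose_eq_0[of k l, where 'p = 'p] by simp
    next
      case False
      have "fps_X ^ (a + k * r + (b + l * r)) dvd (\<Delta> ^^ k) g * (\<Delta> ^^ l) h"
        using g h by (intro fps_X_power_dvd_mult raisesD[OF raises_funpow[OF \<Delta>]])
      moreover have "a + b + ?p * r \<le> a + k * r + (b + l * r)"
        using mult_le_mono1[of ?p "k + l" r] False by (simp add: algebra_simps)
      ultimately show ?thesis
        unfolding mult.assoc by (rule dvd_mult[OF fps_X_power_dvd_mono])
    qed
  qed
qed

lemma raises_trunc_log:
  assumes p: "CARD('p) > 2" and r: "fps_X ^ Suc r dvd f - fps_X"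
  shows "raises r (trunc_log f)"
  unfolding raises_def trunc_log_expansion[OF p]
proof (intro allI impI dvd_sum dvd_mult)
  fix n k and g :: "'p mod_ring fps"
  assume "fps_X ^ n dvd g" "k \<in> {1..<CARD('p)}"
  then have "fps_X ^ (n + k * r) dvd (\<Delta> ^^ k) g" "n + r \<le> n + k * r"
    using raises_compose_diff[OF f0 r]
    by (auto simp: \<Delta>_def intro!: raisesD[OF raises_funpow])
  then show "fps_X ^ (n + r) dvd (\<Delta> ^^ k) g" by (rule fps_X_power_dvd_mono)
qed

lemma trunc_log_second_order:
  assumes p: "CARD('p) > 3" and r: "fps_X ^ Suc r dvd f - fps_X" and g: "fps_X ^ n dvd g"
  shows "fps_X ^ (n + 3 * r) dvd trunc_log f g - (\<Delta> g + fps_const (log_coeff 2) * \<Delta> (\<Delta> g))"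
proof -
  have "{1..<CARD('p)} = insert 1 (insert 2 {3..<CARD('p)})" using p by auto
  then have "trunc_log f g - (\<Delta> g + fps_const (log_coeff 2) * \<Delta> (\<Delta> g))
      = (\<Sum>k\<in>{3..<CARD('p)}. fps_const (log_coeff k) * (\<Delta> ^^ k) g)"
    using p by (simp add: trunc_log_expansion log_coeff_1[simplified] numeral_2_eq_2)
  also have "fps_X ^ (n + 3 * r) dvd \<dots>"
  proof (intro dvd_sum dvd_mult)
    fix k assume "k \<in> {3..<CARD('p)}"
    then have "fps_X ^ (n + k * r) dvd (\<Delta> ^^ k) g" "n + 3 * r \<le> n + k * r"
      using raises_compose_diff[OF f0 r] g
      by (auto simp: \<Delta>_def intro!: raisesD[OF raises_funpow])
    then show "fps_X ^ (n + 3 * r) dvd (\<Delta> ^^ k) g" by (rule fps_X_power_dvd_mono)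
  qed
  finally show ?thesis .
qed

end

section \<open>Exact orders of vanishing\<close>

text \<open>The nonvanishing coefficient makes this false for the zero series, whose
  \<open>subdegree\<close> is 0 by convention.\<close>

definition has_order :: "nat \<Rightarrow> 'a::comm_ring_1 fps \<Rightarrow> bool" where
  "has_order n g \<longleftrightarrow> fps_X ^ n dvd g \<and> fps_nth g n \<noteq> 0"

lemma has_order_iff_subdegree: "has_order n g \<longleftrightarrow> g \<noteq> 0 \<and> subdegree g = n"
  unfolding has_order_def fps_X_power_dvd_iff
  by (auto intro: subdegreeI simp: nth_less_subdegree_zero)

lemma has_order_cong:
  assumes "has_order n g" "fps_X ^ Suc n dvd h - g"
  shows "has_order n h"
proof -
  have "fps_X ^ n dvd h - g" using assms(2) by (rule fps_X_power_dvd_mono) simp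
  then have "fps_X ^ n dvd (h - g) + g" using assms(1) by (intro dvd_add) (simp_all add: has_order_def)
  moreover have "fps_nth (h - g) n = 0" using assms(2) by (simp add: fps_X_power_dvd_iff del: power_Suc)
  ultimately show ?thesis using assms(1) by (simp add: has_order_def)
qed

lemma has_order_mult_iff:
  fixes g h :: "'a::idom fps"
  assumes "has_order m g"
  shows "has_order (m + n) (g * h) \<longleftrightarrow> has_order n h"
  using assms by (auto simp: has_order_iff_subdegree)

lemma has_order_power:
  fixes g :: "'a::idom fps"
  assumes "has_order m g"
  shows "has_order (k * m) (g ^ k)"
  using assms by (simp add: has_order_iff_subdegree)

lemma fps_nth_mult_lowest:
  fixes g h :: "'a::comm_ring_1 fps"
  assumes "fps_X ^ a dvd g" "fps_X ^ b dvd h"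
  shows "fps_nth (g * h) (a + b) = fps_nth g a * fps_nth h b"
proof -
  obtain G H where "g = fps_X ^ a * G" "h = fps_X ^ b * H"
    using assms by (auto elim!: dvdE)
  moreover from this have "g * h = fps_X ^ (a + b) * (G * H)"
    by (simp add: power_add mult_ac)
  ultimately show ?thesis by (simp add: fps_X_power_mult_nth)
qed

lemma fps_nth_vfield_lowest:
  fixes u :: "'a::comm_ring_1 fps"
  assumes u: "fps_X ^ Suc r dvd u" and g: "fps_X ^ n dvd g"
  shows "fps_nth (vfield u g) (n + r) = of_nat n * fps_nth u (Suc r) * fps_nth g n"
proof (cases n)
  case 0
  have "fps_X ^ Suc r dvd u * fps_deriv g" using u by (rule dvd_mult2)
  then show ?thesis using 0 by (simp add: vfield_def fps_X_power_dvd_iff del: power_Suc)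
next
  case (Suc m)
  have "fps_nth (u * fps_deriv g) (Suc r + m) = fps_nth u (Suc r) * fps_nth (fps_deriv g) m"
    using u fps_X_power_dvd_deriv[of m g] g Suc by (intro fps_nth_mult_lowest) simp_all
  then show ?thesis using Suc by (simp add: vfield_def add.commute mult_ac)
qed

lemma fps_nth_vfield_funpow_lowest:
  fixes u :: "'a::comm_ring_1 fps"
  assumes u: "fps_X ^ Suc r dvd u" and g: "fps_X ^ n dvd g"
  shows "fps_nth ((vfield u ^^ k) g) (n + k * r)
    = (\<Prod>i<k. of_nat (n + i * r)) * fps_nth u (Suc r) ^ k * fps_nth g n"
proof (induction k)
  case (Suc k)
  have "fps_X ^ (n + k * r) dvd (vfield u ^^ k) g"
    using raises_funpow[OF raises_vfield[OF u]] g by (rule raisesD)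
  from fps_nth_vfield_lowest[OF u this] Suc show ?case
    by (simp add: mult_ac add_ac)
qed simp

text \<open>The series \<open>c\<close> with \<open>D ^ p = c D\<close> for
  \<open>D = u d/dX\<close>. Since \<open>D ^ p X\<close> is \<open>u\<close> times the derivative
  of \<open>D ^ (p - 1) X\<close>, no division by \<open>u\<close> is required.\<close>

definition vfield_multiplier :: "'p::prime_card mod_ring fps \<Rightarrow> 'p mod_ring fps" where
  "vfield_multiplier u = fps_deriv ((vfield u ^^ (CARD('p) - 1)) fps_X)"

lemma vfield_power_card_X:
  fixes u :: "'p::prime_card mod_ring fps"
  shows "(vfield u ^^ CARD('p)) fps_X = vfield_multiplier u * u"
proof -
  have "(vfield u ^^ Suc (CARD('p) - 1)) fps_X = u * vfield_multiplier u"
    by (simp only: funpow.simps o_apply vfield_multiplier_def vfield_def)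
  then show ?thesis by (simp add: mult.commute del: funpow.simps)
qed

lemma vfield_power_card_eq_multiplier:
  fixes u :: "'p::prime_card mod_ring fps"
  assumes "fps_nth u 0 = 0"
  shows "(vfield u ^^ CARD('p)) g = vfield_multiplier u * vfield u g"
  using vfield_power_card[OF assms, of g] by (simp add: vfield_power_card_X vfield_def mult.assoc)

text \<open>\<open>D\<close> commutes with \<open>D ^ p = c D\<close>. Comparing both orders of
  application on \<open>X\<close> gives \<open>u * u * c' = 0\<close>.\<close>

lemma vfield_multiplier_constant:
  fixes u :: "'p::prime_card mod_ring fps"
  assumes "fps_nth u 0 = 0" "u \<noteq> 0"
  shows "fps_deriv (vfield_multiplier u) = 0"
proof -
  let ?c = "vfield_multiplier u"
  have "vfield u ((vfield u ^^ CARD('p)) fps_X) = (vfield u ^^ CARD('p)) (vfield u fps_X)"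
    by (simp add: funpow_swap1)
  then have "u * (fps_deriv ?c * u + ?c * fps_deriv u) = ?c * (u * fps_deriv u)"
    unfolding vfield_power_card_eq_multiplier[OF assms(1)] by (simp add: vfield_def algebra_simps)
  then have "u * u * fps_deriv ?c = 0" by (simp add: algebra_simps)
  then show ?thesis using assms(2) by simp
qed

lemma has_order_vfield_power_card_iff:
  fixes u :: "'p::prime_card mod_ring fps"
  assumes "has_order (Suc r) u"
  shows "has_order (Suc (s + r)) ((vfield u ^^ CARD('p)) fps_X) \<longleftrightarrow> has_order s (vfield_multiplier u)"
  using has_order_mult_iff[OF assms, of s "vfield_multiplier u"]
  by (simp add: vfield_power_card_X mult.commute add.commute)

section \<open>From one iterate to its \<open>p\<close>-th iterate\<close>

text \<open>\<open>L\<close> and \<open>D\<close> both gain \<open>r\<close> and differ by relative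
  order \<open>p r\<close>, so their \<open>p\<close>-th powers differ by
  \<open>(p - 1) r + p r\<close>. The \<open>p\<close>-th power of \<open>L\<close> is the logarithm
  of the \<open>p\<close>-th iterate.\<close>

lemma trunc_log_iterate_approx:
  fixes f :: "'p::prime_card mod_ring fps"
  assumes p: "CARD('p) > 2" and f: "fps_nth f 0 = 0" "fps_X ^ Suc r dvd f - fps_X"
  shows "fps_X ^ Suc ((2 * CARD('p) - 1) * r) dvd
    trunc_log (fps_iterate f CARD('p)) fps_X - (vfield (trunc_log f fps_X) ^^ CARD('p)) fps_X"
proof -
  let ?p = "CARD('p)" and ?u = "trunc_log f fps_X"
  have L: "fps_linear (trunc_log f)" "raises r (trunc_log f)"
    using f p by (auto simp: trunc_log_def intro: act_linear raises_trunc_log[unfolded trunc_log_def])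
  have "fps_X ^ (1 + r) dvd ?u"
    using L(2) by (rule raisesD) simp
  then have "raises r (vfield ?u)" by (intro raises_vfield) simp
  then have "raises ((?p - 1) * r + ?p * r) (\<lambda>g. (trunc_log f ^^ Suc (?p - 1)) g - (vfield ?u ^^ Suc (?p - 1)) g)"
    using L trunc_log_near_derivation[OF f(1) p f(2)] by (intro raises_funpow_diff)
  then have "fps_X ^ (1 + ((?p - 1) * r + ?p * r)) dvd
      (trunc_log f ^^ Suc (?p - 1)) fps_X - (vfield ?u ^^ Suc (?p - 1)) fps_X"
    by (rule raisesD) simp
  moreover have "(?p - 1) * r + ?p * r = (2 * ?p - 1) * r"
  proof -
    have "(?p - 1) + ?p = 2 * ?p - 1" using p by linarith
    then show ?thesis by (metis add_mult_distrib)
  qed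
  ultimately show ?thesis
    using f(1) by (simp add: trunc_log_power_card del: funpow.simps)
qed

text \<open>Writing \<open>u' = c (u + \<delta>)\<close> with \<open>c\<close> the multiplier of \<open>u\<close>, the constant \<open>c\<close> can be pulled
  out of the \<open>p\<close>-th power of \<open>vfield u'\<close>, and \<open>\<delta>\<close> is negligible in what remains.\<close>

lemma vfield_power_card_step:
  fixes u u' :: "'p::prime_card mod_ring fps"
  assumes u: "has_order (Suc r) u" and c: "has_order s (vfield_multiplier u)"
    and u': "fps_X ^ Suc ((2 * CARD('p) - 1) * r) dvd u' - (vfield u ^^ CARD('p)) fps_X"
    and s1: "s + r < (2 * CARD('p) - 1) * r"
    and s2: "2 * s + r < (CARD('p) - 1) * r + (2 * CARD('p) - 1) * r"
  shows "has_order (Suc (s + r)) u'"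
    and "has_order (CARD('p) * s) (vfield_multiplier u')"
proof -
  let ?p = "CARD('p)"
  define N where "N = (2 * ?p - 1) * r"
  define c where "c = vfield_multiplier u"
  have u0: "fps_nth u 0 = 0" and u_nz: "u \<noteq> 0"
    using u by (auto simp: has_order_def fps_X_power_dvd_iff simp del: power_Suc)
  have c_const: "fps_deriv c = 0"
    unfolding c_def using u0 u_nz by (rule vfield_multiplier_constant)
  have Xp: "has_order (Suc (s + r)) ((vfield u ^^ ?p) fps_X)"
    using has_order_vfield_power_card_iff[OF u] c by blast
  show u'_order: "has_order (Suc (s + r)) u'"
  proof (rule has_order_cong[OF Xp])
    show "fps_X ^ Suc (Suc (s + r)) dvd u' - (vfield u ^^ ?p) fps_X"
      using u' by (rule fps_X_power_dvd_mono) (use s1 in simp)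
  qed
  obtain c1 where c1: "c = fps_X ^ s * c1" using c by (auto simp: has_order_def c_def)
  have "fps_nth c1 0 \<noteq> 0"
    using c by (simp add: has_order_def c1 fps_X_power_mult_nth flip: c_def)
  then have c1_inv: "c1 * inverse c1 = 1" by (simp add: inverse_mult_eq_1')
  obtain w where w: "u' - c * u = fps_X ^ Suc N * w"
    using u' by (auto simp: vfield_power_card_X N_def c_def)
  \<comment> \<open>The error \<open>u' - c u\<close> divided by \<open>c\<close>: the unit part
    \<open>c1\<close> is inverted and the factor \<open>X ^ s\<close> lowers the exponent.\<close>
  define \<delta> where "\<delta> = fps_X ^ (Suc N - s) * (w * inverse c1)"
  have "s + r < N" using s1 by (simp add: N_def)
  have "c * \<delta> = fps_X ^ s * fps_X ^ (Suc N - s) * w * (c1 * inverse c1)"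
    by (simp add: c1 \<delta>_def mult_ac)
  also have "\<dots> = u' - c * u"
    using \<open>s + r < N\<close> by (simp add: w c1_inv flip: power_add del: power_Suc)
  finally have u'_eq: "u' = c * (u + \<delta>)" by (simp add: algebra_simps)
  have vfield_u': "(vfield u' ^^ k) g = c ^ k * (vfield (u + \<delta>) ^^ k) g" for k g
  proof (induction k)
    case (Suc k)
    have "fps_deriv (c ^ k) = 0" by (simp add: fps_deriv_power' c_const)
    then have "vfield u' (c ^ k * h) = c ^ Suc k * vfield (u + \<delta>) h" for h
      by (simp add: u'_eq vfield_def mult_ac)
    then show ?case by (simp add: Suc)
  qed simp
  have \<delta>_dvd: "fps_X ^ Suc (N - s) dvd \<delta>"
    using \<open>s + r < N\<close> by (simp add: \<delta>_def Suc_diff_le del: power_Suc)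
  have u_dvd: "fps_X ^ Suc r dvd u" using u by (simp add: has_order_def)
  have "fps_X ^ Suc r dvd \<delta>"
    using \<delta>_dvd by (rule fps_X_power_dvd_mono) (use \<open>s + r < N\<close> in simp)
  then have "fps_X ^ Suc r dvd u + \<delta>" using u_dvd by (rule dvd_add[rotated])
  have "(\<lambda>g. vfield (u + \<delta>) g - vfield u g) = vfield \<delta>"
    by (simp add: fun_eq_iff vfield_def algebra_simps)
  then have "raises (N - s) (\<lambda>g. vfield (u + \<delta>) g - vfield u g)"
    using \<delta>_dvd by (simp add: raises_vfield del: power_Suc)
  then have "raises ((?p - 1) * r + (N - s)) (\<lambda>g. (vfield (u + \<delta>) ^^ Suc (?p - 1)) g - (vfield u ^^ Suc (?p - 1)) g)"
    using \<open>fps_X ^ Suc r dvd u + \<delta>\<close> u_dvd by (intro raises_funpow_diff vfield_linear raises_vfield)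
  then have "fps_X ^ (1 + ((?p - 1) * r + (N - s))) dvd
      (vfield (u + \<delta>) ^^ Suc (?p - 1)) fps_X - (vfield u ^^ Suc (?p - 1)) fps_X"
    by (rule raisesD) simp
  then have "fps_X ^ (1 + ((?p - 1) * r + (N - s))) dvd (vfield (u + \<delta>) ^^ ?p) fps_X - (vfield u ^^ ?p) fps_X"
    by (simp del: funpow.simps)
  \<comment> \<open>This is exactly the role of \<open>s2\<close>: the perturbation by
    \<open>\<delta>\<close> must stay beyond the leading term of \<open>D ^ p X\<close>.\<close>
  moreover have "Suc (Suc (s + r)) \<le> 1 + ((?p - 1) * r + (N - s))"
    using s2 \<open>s + r < N\<close> unfolding N_def[symmetric] by linarith
  ultimately have "has_order (Suc (s + r)) ((vfield (u + \<delta>) ^^ ?p) fps_X)"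
    by (intro has_order_cong[OF Xp]) (rule fps_X_power_dvd_mono)
  moreover have "has_order (?p * s) (c ^ ?p)"
    using c by (intro has_order_power) (simp add: c_def)
  \<comment> \<open>The factor \<open>c ^ p\<close> contributes \<open>p * s\<close>; dividing by
    \<open>u'\<close>, of order \<open>s + r + 1\<close>, leaves the order of the new
    multiplier.\<close>
  ultimately have "has_order (?p * s + Suc (s + r)) ((vfield u' ^^ ?p) fps_X)"
    by (simp only: vfield_u' has_order_mult_iff)
  then show "has_order (?p * s) (vfield_multiplier u')"
    using has_order_vfield_power_card_iff[OF u'_order, of "?p * s"] by simp
qed

text \<open>The linear term of the logarithm gives \<open>f - X\<close>; every further application
  of \<open>\<Delta>\<close> gains \<open>r > 0\<close>, so the leading term survives.\<close>

lemma has_order_trunc_log: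
  fixes f :: "'p::prime_card mod_ring fps"
  assumes p: "CARD('p) > 3" and f0: "fps_nth f 0 = 0" and r: "0 < r"
    and f: "has_order (Suc r) (f - fps_X)"
  shows "has_order (Suc r) (trunc_log f fps_X)"
proof (rule has_order_cong[OF f])
  have dvd: "fps_X ^ Suc r dvd f - fps_X" using f by (simp add: has_order_def)
  let ?\<Delta> = "\<lambda>g. (g oo f) - g"
  have \<Delta>: "raises r ?\<Delta>" using f0 dvd by (rule raises_compose_diff)
  have \<Delta>X: "?\<Delta> fps_X = f - fps_X" using f0 by simp
  have "fps_X ^ (1 + 3 * r) dvd
      trunc_log f fps_X - (?\<Delta> fps_X + fps_const (log_coeff 2) * ?\<Delta> (?\<Delta> fps_X))"
    by (rule trunc_log_second_order[OF f0 p dvd]) simp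
  then have "fps_X ^ Suc (Suc r) dvd
      trunc_log f fps_X - (?\<Delta> fps_X + fps_const (log_coeff 2) * ?\<Delta> (?\<Delta> fps_X))"
    by (rule fps_X_power_dvd_mono) (use r in simp)
  moreover have "fps_X ^ (Suc r + r) dvd ?\<Delta> (?\<Delta> fps_X)"
    using \<Delta> dvd unfolding \<Delta>X by (rule raisesD)
  then have "fps_X ^ Suc (Suc r) dvd fps_const (log_coeff 2) * ?\<Delta> (?\<Delta> fps_X)"
    using r by (intro dvd_mult fps_X_power_dvd_mono[of "Suc r + r" _ "Suc (Suc r)"]) simp_all
  ultimately have "fps_X ^ Suc (Suc r) dvd
      (trunc_log f fps_X - (?\<Delta> fps_X + fps_const (log_coeff 2) * ?\<Delta> (?\<Delta> fps_X)))
      + fps_const (log_coeff 2) * ?\<Delta> (?\<Delta> fps_X)"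
    by (rule dvd_add)
  then show "fps_X ^ Suc (Suc r) dvd trunc_log f fps_X - (f - fps_X)"
    by (simp only: \<Delta>X) (simp add: algebra_simps)
qed

lemma has_order_trunc_log_iff:
  fixes f :: "'p::prime_card mod_ring fps"
  assumes p: "CARD('p) > 3" and f: "f \<in> nottingham"
  shows "has_order n (trunc_log f fps_X) \<longleftrightarrow> has_order n (f - fps_X)"
proof -
  have f0: "fps_nth f 0 = 0" and f1: "fps_nth f 1 = 1" using f by (auto simp: nottingham_def)
  have "has_order (subdegree (f - fps_X)) (trunc_log f fps_X)" if "f \<noteq> fps_X"
  proof -
    have "f - fps_X \<noteq> 0" using that by simp
    moreover from this have "2 \<le> subdegree (f - fps_X)"
      using f0 f1 by (intro subdegree_geI) (auto simp: less_2_cases_iff)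
    moreover define r where "r = subdegree (f - fps_X) - 1"
    ultimately have "subdegree (f - fps_X) = Suc r" "0 < r" "has_order (Suc r) (f - fps_X)"
      by (auto simp: has_order_iff_subdegree)
    then show ?thesis using has_order_trunc_log[OF p f0] by simp
  qed
  moreover have "trunc_log f fps_X = 0" if "f = fps_X"
  proof (rule fps_eq_0_if_all_powers_dvd)
    fix n
    have "raises n (trunc_log f)"
      using p f0 that by (intro raises_trunc_log) simp_all
    from raisesD[OF this, of 0] show "fps_X ^ n dvd trunc_log f fps_X" by simp
  qed
  ultimately show ?thesis
    by (cases "f = fps_X") (auto simp: has_order_iff_subdegree)
qed

section \<open>The first multiplier\<close>

lemma two_log_coeff_2: "CARD('p::prime_card) > 2 \<Longrightarrow> (4 :: 'p mod_ring) * log_coeff 2 = - 2"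
  using arg_cong[OF log_coeff_2[where 'p = 'p], of "(*) 2"] by (simp flip: mult.assoc)

text \<open>With \<open>r = 3\<close> the terms from the third power of \<open>\<Delta>\<close> on
  start at \<open>X ^ 10\<close>, and the second power starts at \<open>X ^ 7\<close>. Thus only the
  last coefficient is corrected, by \<open>-1/2\<close> times 4 times the square of the leading
  one.\<close>

lemma trunc_log_coeffs:
  fixes f :: "'p::prime_card mod_ring fps"
  assumes p: "CARD('p) > 3" and f0: "fps_nth f 0 = 0" and f: "fps_X ^ 4 dvd f - fps_X"
  defines "u \<equiv> trunc_log f fps_X"
  shows "fps_X ^ 4 dvd u"
    and "fps_nth u 4 = fps_nth f 4" "fps_nth u 5 = fps_nth f 5" "fps_nth u 6 = fps_nth f 6"
    and "fps_nth u 7 = fps_nth f 7 - 2 * fps_nth f 4 ^ 2"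
proof -
  let ?\<Delta> = "\<lambda>g. (g oo f) - g"
  define h where "h = f - fps_X"
  have f_dvd: "fps_X ^ Suc 3 dvd f - fps_X" using f by (simp add: numeral_eq_Suc)
  have \<Delta>: "raises 3 ?\<Delta>" using f0 f_dvd by (rule raises_compose_diff)
  have \<Delta>X: "?\<Delta> fps_X = h" using f0 by (simp add: h_def)
  have "fps_X ^ (1 + 3 * 3) dvd
      trunc_log f fps_X - (?\<Delta> fps_X + fps_const (log_coeff 2) * ?\<Delta> (?\<Delta> fps_X))"
    by (rule trunc_log_second_order[OF f0 p f_dvd]) simp
  then have u: "fps_nth u i = fps_nth h i + log_coeff 2 * fps_nth (?\<Delta> h) i" if "i < 10" for i
    using that unfolding \<Delta>X by (simp add: u_def fps_X_power_dvd_iff)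
  have h4: "fps_X ^ 4 dvd h" using f by (simp add: h_def)
  have "fps_X ^ (4 + 3) dvd ?\<Delta> h" using \<Delta> h4 by (rule raisesD)
  then have \<Delta>h: "fps_nth (?\<Delta> h) i = 0" if "i < 7" for i
    using that by (simp add: fps_X_power_dvd_iff)
  obtain w where w: "h = fps_X ^ 4 * w" using h4 by (rule dvdE)
  have f_eq: "f = fps_X * (1 + fps_X ^ 3 * w)"
    using w by (simp add: h_def algebra_simps eval_nat_numeral)
  \<comment> \<open>Without its leading term \<open>h\<close> has order at least 5, so
    \<open>\<Delta> t\<close> starts at \<open>X ^ 8\<close> and is invisible at
    \<open>X ^ 7\<close>.\<close>
  define t where "t = h - fps_const (fps_nth h 4) * fps_X ^ 4"
  have "fps_X ^ 5 dvd t"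
    using h4 by (auto simp: t_def fps_X_power_dvd_iff fps_X_power_nth)
  from raisesD[OF \<Delta> this] have "fps_nth (?\<Delta> t) 7 = 0" by (simp add: fps_X_power_dvd_iff)
  moreover have "?\<Delta> h = fps_const (fps_nth h 4) * (f ^ 4 - fps_X ^ 4) + ?\<Delta> t"
  proof -
    have "(fps_const (fps_nth h 4) * fps_X ^ 4) oo f = fps_const (fps_nth h 4) * f ^ 4"
      using f0 by (simp add: compose_scale fps_compose_power[symmetric])
    then show ?thesis by (simp add: t_def fps_compose_sub_distrib algebra_simps)
  qed
  moreover have "fps_nth (f ^ 4 - fps_X ^ 4) 7 = 4 * fps_nth h 4"
  proof -
    have expand: "(x * (1 + y)) ^ 4 - x ^ 4 = x ^ 4 * (y * (4 + y * (6 + 4 * y + y ^ 2)))"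
      for x y :: "'p mod_ring fps" by (simp add: algebra_simps eval_nat_numeral)
    define v where "v = w * (6 + 4 * (fps_X ^ 3 * w) + (fps_X ^ 3 * w) ^ 2)"
    have "f ^ 4 - fps_X ^ 4 = fps_X ^ (4 + 3) * (w * (4 + fps_X ^ 3 * v))"
      unfolding f_eq expand v_def power_add by (simp only: mult_ac)
    then show ?thesis by (simp add: w fps_X_power_mult_nth)
  qed
  ultimately have \<Delta>h7: "fps_nth (?\<Delta> h) 7 = 4 * fps_nth h 4 ^ 2"
    by (simp add: power2_eq_square)
  have h_nth: "fps_nth h i = fps_nth f i" if "1 < i" for i
    using that by (simp add: h_def)
  show "fps_X ^ 4 dvd u"
    using h4 \<Delta>h u by (simp add: fps_X_power_dvd_iff)
  show "fps_nth u 4 = fps_nth f 4" "fps_nth u 5 = fps_nth f 5" "fps_nth u 6 = fps_nth f 6"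
    using \<Delta>h[of 4] \<Delta>h[of 5] \<Delta>h[of 6] by (simp_all add: u h_nth del: fps_sub_nth)
  show "fps_nth u 7 = fps_nth f 7 - 2 * fps_nth f 4 ^ 2"
  proof -
    have "fps_nth u 7 = fps_nth f 7 + (4 * log_coeff 2) * fps_nth f 4 ^ 2"
      using \<Delta>h7 by (simp add: u h_nth del: fps_sub_nth)
    also have "\<dots> = fps_nth f 7 - 2 * fps_nth f 4 ^ 2"
      using p by (subst two_log_coeff_2) simp_all
    finally show ?thesis .
  qed
qed

lemma fps_deriv_scaled_X_power:
  fixes c :: "'a::field"
  assumes "of_nat (Suc n) \<noteq> (0 :: 'a)"
  shows "fps_deriv (fps_const (c / of_nat (Suc n)) * fps_X ^ Suc n) = fps_const c * fps_X ^ n"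
proof (rule fps_ext)
  fix k
  show "fps_nth (fps_deriv (fps_const (c / of_nat (Suc n)) * fps_X ^ Suc n)) k
      = fps_nth (fps_const c * fps_X ^ n) k"
    unfolding fps_deriv_nth fps_mult_left_const_nth fps_X_power_nth using assms by auto
qed

text \<open>The form \<open>dX / u\<close> is integrated up to its residue: for a truncation \<open>G\<close> of
  \<open>X\<^sup>p \<integral> dX / u\<close>, we have \<open>u G' = X\<^sup>p K\<close> with \<open>K = 1 + \<eta> X\<^sup>3 + \<dots>\<close>,
  and \<open>c K\<close> is the image of \<open>K\<close> under the \<open>(p-1)\<close>-st power of \<open>vfield u\<close>.\<close>

lemma vfield_multiplier_order:
  fixes u :: "'p::prime_card mod_ring fps"
  assumes p: "CARD('p) > 3" and u: "has_order 4 u"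
  defines "b \<equiv> \<lambda>i. fps_nth u (3 + i)"
  shows "has_order (3 * CARD('p)) (vfield_multiplier u)
     \<longleftrightarrow> b 2 ^ 3 - 2 * b 1 * b 2 * b 3 + b 1 ^ 2 * b 4 \<noteq> 0"
proof -
  let ?p = "CARD('p)"
  have u_dvd: "fps_X ^ Suc 3 dvd u" and b1: "b 1 \<noteq> 0" and u0: "fps_nth u 0 = 0"
    using u by (auto simp: has_order_def numeral_eq_Suc b_def fps_X_power_dvd_iff simp del: power_Suc)
  obtain U where U: "u = fps_X ^ 4 * U" using u by (auto simp: has_order_def)
  have U_nth: "fps_nth U i = b (Suc i)" for i
    using fps_X_power_mult_nth[of 4 U "4 + i"] by (simp add: b_def U)
  \<comment> \<open>The coefficients of \<open>1 / U\<close> up to \<open>X ^ 2\<close>, so that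
    \<open>U * E\<close> is 1 up to order 3.\<close>
  define e :: "nat \<Rightarrow> 'p mod_ring" where "e = (\<lambda>_. 0)(0 := 1 / b 1, 1 := - b 2 / b 1 ^ 2, 2 := b 2 ^ 2 / b 1 ^ 3 - b 3 / b 1 ^ 2)"
  define E where "E = (\<Sum>i<3. fps_const (e i) * fps_X ^ i)"
  \<comment> \<open>Termwise integration is possible since \<open>p - 3\<close>,
    \<open>p - 2\<close>, \<open>p - 1\<close> are nonzero modulo \<open>p\<close>. The next
    exponent would be \<open>p\<close>: this is the residue obstruction, and \<open>\<eta>\<close>
    equals \<open>- b 1\<close> times the residue of \<open>dX / u\<close>.\<close>
  define G where "G = (\<Sum>i<3. fps_const (e i / of_nat (?p - 3 + i)) * fps_X ^ (?p - 3 + i))"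
  define K where "K = U * E"
  define \<eta> where "\<eta> = fps_nth K 3"
  have E_nth: "fps_nth E i = e i" for i
  proof -
    have "fps_nth E i = (\<Sum>j<3. if j = i then e j else 0)"
      unfolding E_def fps_sum_nth by (intro sum.cong) (auto simp: fps_X_power_nth)
    then show ?thesis by (auto simp: e_def sum.delta)
  qed
  have K_nth: "fps_nth K 0 = 1" "fps_nth K 1 = 0" "fps_nth K 2 = 0"
    and \<eta>: "\<eta> = (b 2 ^ 3 - 2 * b 1 * b 2 * b 3 + b 1 ^ 2 * b 4) / b 1 ^ 3"
    using b1 by (simp_all add: \<eta>_def K_def fps_mult_nth E_nth U_nth e_def eval_nat_numeral field_simps)
  have "fps_deriv G = fps_X ^ (?p - 4) * E"
  proof -
    have "fps_deriv (fps_const (e i / of_nat (?p - 3 + i)) * fps_X ^ (?p - 3 + i))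
        = fps_X ^ (?p - 4) * (fps_const (e i) * fps_X ^ i)" if "i < 3" for i
    proof -
      have "(of_nat (?p - 3 + i) :: 'p mod_ring) \<noteq> 0"
        using that p by (intro of_nat_mod_ring_neq_0) auto
      moreover have "?p - 3 + i = Suc (?p - 4 + i)" using p by simp
      ultimately have "fps_deriv (fps_const (e i / of_nat (?p - 3 + i)) * fps_X ^ (?p - 3 + i))
          = fps_const (e i) * fps_X ^ (?p - 4 + i)"
        by (metis fps_deriv_scaled_X_power)
      then show ?thesis by (simp add: power_add mult_ac)
    qed
    then show ?thesis by (simp add: G_def E_def fps_deriv_sum sum_distrib_left)
  qed
  then have vfield_G: "vfield u G = fps_X ^ ?p * K"
  proof -
    have "vfield u G = fps_X ^ (4 + (?p - 4)) * (U * E)"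
      unfolding vfield_def \<open>fps_deriv G = _\<close> by (simp add: U power_add mult_ac)
    then show ?thesis using p by (simp add: K_def)
  qed
  \<comment> \<open>\<open>D ^ p G\<close> is computed twice: as \<open>c\<close> times
    \<open>D G\<close>, and as \<open>D ^ (p - 1)\<close> of \<open>D G\<close>, where
    \<open>X ^ p\<close> behaves as a constant.\<close>
  have "(vfield u ^^ ?p) G = (vfield u ^^ Suc (?p - 1)) G" by (simp del: funpow.simps)
  also have "\<dots> = (vfield u ^^ (?p - 1)) (fps_X ^ ?p * K)"
    by (simp only: funpow_Suc_right o_apply vfield_G)
  also have "\<dots> = fps_X ^ ?p * (vfield u ^^ (?p - 1)) K"
  proof (rule vfield_funpow_mult_constant)
    show "fps_deriv (fps_X ^ ?p :: 'p mod_ring fps) = 0"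
      using of_nat_card_eq_0[where 'a = 'p] by (simp add: fps_deriv_power' flip: fps_of_nat)
  qed
  finally have "fps_X ^ ?p * (vfield_multiplier u * K) = fps_X ^ ?p * (vfield u ^^ (?p - 1)) K"
    unfolding vfield_power_card_eq_multiplier[OF u0] vfield_G by (simp add: mult_ac)
  then have cK: "vfield_multiplier u * K = (vfield u ^^ (?p - 1)) K" by simp
  \<comment> \<open>Derivations kill constants, so \<open>K\<close> may be replaced by
    \<open>K - 1\<close>, whose leading term is \<open>\<eta> X ^ 3\<close>.\<close>
  have "(vfield u ^^ (?p - 1)) 1 = 0"
  proof -
    have "(vfield u ^^ Suc (?p - 2)) 1 = (vfield u ^^ (?p - 2)) 0"
      by (simp only: funpow_Suc_right o_apply) (simp add: vfield_def)
    also have "\<dots> = 0" by (intro fps_linear_0 fps_linear_funpow vfield_linear)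
    finally show ?thesis using p by (simp add: Suc_diff_Suc numeral_2_eq_2 del: funpow.simps)
  qed
  then have cK1: "vfield_multiplier u * K = (vfield u ^^ (?p - 1)) (K - 1)"
    unfolding cK fps_linear_diff[OF fps_linear_funpow[OF vfield_linear]] by simp
  have K1: "fps_X ^ 3 dvd K - 1"
    unfolding fps_X_power_dvd_iff
  proof (intro allI impI)
    fix i :: nat
    assume "i < 3"
    then have "i = 0 \<or> i = 1 \<or> i = 2" by linarith
    then show "fps_nth (K - 1) i = 0" using K_nth by auto
  qed
  have exponent: "3 + (?p - 1) * 3 = 3 * ?p" using p by simp
  have "fps_X ^ (3 * ?p) dvd vfield_multiplier u * K"
    unfolding cK1 using raisesD[OF raises_funpow[OF raises_vfield[OF u_dvd]] K1, of "?p - 1"] exponent by simp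
  moreover have "fps_nth (vfield_multiplier u * K) (3 * ?p) = (\<Prod>i<?p - 1. of_nat (3 + i * 3)) * b 1 ^ (?p - 1) * \<eta>"
    unfolding cK1 using fps_nth_vfield_funpow_lowest[OF u_dvd K1, of "?p - 1"]
    unfolding exponent by (simp add: b_def \<eta>_def)
  \<comment> \<open>The factors are \<open>3 (i + 1)\<close> with \<open>i + 1 < p\<close>, nonzero
    modulo \<open>p\<close> because \<open>p > 3\<close>.\<close>
  moreover have "(\<Prod>i<?p - 1. of_nat (3 + i * 3)) \<noteq> (0 :: 'p mod_ring)"
  proof -
    have "(of_nat (3 * Suc i) :: 'p mod_ring) \<noteq> 0" if "i < ?p - 1" for i
    proof -
      have "(of_nat 3 :: 'p mod_ring) \<noteq> 0" "(of_nat (Suc i) :: 'p mod_ring) \<noteq> 0"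
        using that p by (intro of_nat_mod_ring_neq_0; simp)+
      then show ?thesis unfolding of_nat_mult by (rule no_zero_divisors)
    qed
    then show ?thesis by (simp add: algebra_simps)
  qed
  ultimately have "has_order (3 * ?p) (vfield_multiplier u * K) \<longleftrightarrow> \<eta> \<noteq> 0"
    using b1 by (simp add: has_order_def)
  moreover have "has_order (0 + 3 * ?p) (K * vfield_multiplier u) \<longleftrightarrow> has_order (3 * ?p) (vfield_multiplier u)"
    using K_nth by (intro has_order_mult_iff) (simp add: has_order_def)
  ultimately show ?thesis
    using b1 by (simp add: mult.commute \<eta>)
qed

section \<open>Ramification numbers\<close>

lemma fps_iterate_nottingham:
  fixes f :: "'a::comm_ring_1 fps"
  assumes "f \<in> nottingham"
  shows "fps_iterate f m \<in> nottingham"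
proof (induction m)
  case (Suc m)
  then show ?case
    using assms by (simp add: nottingham_def fps_iterate_Suc fps_compose_nth)
qed (simp add: nottingham_def)

text \<open>For \<open>g = X\<close> both sides are false. Otherwise the valuation is at least 2 and
  the subtraction of 1 shifts the order to \<open>Suc r\<close>.\<close>

lemma ramification_eq_iff:
  fixes g :: "'a::comm_ring_1 fps"
  assumes "g \<in> nottingham"
  shows "ramification g = enat r \<longleftrightarrow> has_order (Suc r) (g - fps_X)"
proof (cases "g = fps_X")
  case False
  then have "1 < subdegree (g - fps_X)"
    using assms by (intro subdegree_greaterI) (auto simp: nottingham_def le_Suc_eq)
  then show ?thesis
    using False by (auto simp: ramification_def val_X_def has_order_iff_subdegree one_enat_def)
qed (simp add: ramification_def val_X_def has_order_iff_subdegree)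

lemma ramification_number_eq_iff:
  fixes f :: "'p::prime_card mod_ring fps"
  assumes "CARD('p) > 3" "f \<in> nottingham"
  shows "ramification_number n f = enat r
    \<longleftrightarrow> has_order (Suc r) (trunc_log (fps_iterate f (CARD('p) ^ n)) fps_X)"
  using assms by (simp add: ramification_number_def ramification_eq_iff has_order_trunc_log_iff fps_iterate_nottingham)

text \<open>One direction inducts on \<open>n\<close>, carrying the order \<open>R n + 1\<close> of
  the logarithm \<open>u n\<close> together with the order \<open>S n\<close> of its multiplier. The
  converse uses only the ramification number at \<open>n = 1\<close>.\<close>

lemma ramification_numbers_iff_multiplier:
  fixes f :: "'p::prime_card mod_ring fps"
  assumes p: "CARD('p) > 3" and f: "f \<in> nottingham"
    and u: "has_order 4 (trunc_log f fps_X)"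
  shows "(\<forall>n. ramification_number n f = enat (3 * (\<Sum>k\<le>n. CARD('p) ^ k)))
     \<longleftrightarrow> has_order (3 * CARD('p)) (vfield_multiplier (trunc_log f fps_X))"
proof -
  let ?p = "CARD('p)"
  define F where "F n = fps_iterate f (?p ^ n)" for n
  define u where "u n = trunc_log (F n) fps_X" for n
  define R where "R n = 3 * (\<Sum>k\<le>n. ?p ^ k)" for n
  define S where "S n = 3 * ?p ^ Suc n" for n
  have f0: "fps_nth f 0 = 0" using f by (simp add: nottingham_def)
  have F_nott: "F n \<in> nottingham" for n
    unfolding F_def using f by (rule fps_iterate_nottingham)
  have F0: "fps_nth (F n) 0 = 0" for n using F_nott by (simp add: nottingham_def)
  have F_Suc: "F (Suc n) = fps_iterate (F n) ?p" for n
    using f0 by (simp add: F_def mult.commute flip: fps_iterate_mult)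
  have order_F: "has_order (Suc (R n)) (F n - fps_X) \<longleftrightarrow> has_order (Suc (R n)) (u n)" for n
    unfolding u_def using has_order_trunc_log_iff[OF p F_nott] by blast
  have RS: "R n * (?p - 1) + 3 = S n" for n
  proof -
    have "R n * (?p - 1) + 3 = 3 * ((\<Sum>k<Suc n. ?p ^ k) * (?p - 1) + 1)"
      by (simp only: R_def lessThan_Suc_atMost) (simp add: algebra_simps)
    also have "(\<Sum>k<Suc n. ?p ^ k) * (?p - 1) + 1 = ?p ^ Suc n"
    proof -
      have "(\<Sum>k<m. Suc q ^ k) * q + 1 = Suc q ^ m" for m q
        by (induction m) (simp_all add: algebra_simps)
      from this[where m = "Suc n" and q = "?p - 1"] show ?thesis using p by simp
    qed
    finally show ?thesis by (simp only: S_def)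
  qed
  have R_Suc: "R (Suc n) = S n + R n" for n by (simp add: R_def S_def)
  have approx: "fps_X ^ Suc ((2 * ?p - 1) * R n) dvd u (Suc n) - (vfield (u n) ^^ ?p) fps_X"
    if "has_order (Suc (R n)) (u n)" for n
    unfolding u_def F_Suc
  proof (rule trunc_log_iterate_approx)
    show "fps_X ^ Suc (R n) dvd F n - fps_X"
      using that order_F[of n] unfolding has_order_def by blast
  qed (use p F0 in auto)
  \<comment> \<open>With \<open>m = S n - 3\<close> these amount to \<open>m > 3\<close> and
    \<open>m > 6\<close>; both follow from \<open>S n \<ge> 3 p > 9\<close>.\<close>
  have bounds: "S n + R n < (2 * ?p - 1) * R n" "2 * S n + R n < (?p - 1) * R n + (2 * ?p - 1) * R n" for n
  proof -
    define m where "m = R n * (?p - 1)"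
    have "1 \<le> ?p ^ n" by simp
    then have "?p \<le> ?p ^ Suc n" by simp
    then have "9 < S n" using p unfolding S_def by linarith
    have S: "S n = m + 3" using RS[of n] by (simp add: m_def)
    have "2 * ?p - 1 = 2 * (?p - 1) + 1" using p by simp
    moreover have "(2 * x + 1) * y = 2 * (y * x) + y" for x y :: nat by (simp add: algebra_simps)
    ultimately have e: "(2 * ?p - 1) * R n = 2 * m + R n" "(?p - 1) * R n = m"
      unfolding m_def by (metis, metis mult.commute)
    show "S n + R n < (2 * ?p - 1) * R n" "2 * S n + R n < (?p - 1) * R n + (2 * ?p - 1) * R n"
      unfolding e using S \<open>9 < S n\<close> by linarith+
  qed
  have u0: "u 0 = trunc_log f fps_X" using f0 by (simp add: u_def F_def fps_iterate_1)
  have R0: "R 0 = 3" and S0: "S 0 = 3 * ?p" by (simp_all add: R_def S_def)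
  have order_0: "has_order (Suc (R 0)) (u 0)" using u by (simp add: u0 R0)
  have "has_order (Suc (R n)) (u n)" if c: "has_order (S 0) (vfield_multiplier (u 0))" for n
  proof -
    have "has_order (Suc (R n)) (u n) \<and> has_order (S n) (vfield_multiplier (u n))"
    proof (induction n)
      case (Suc n)
      then have step: "has_order (Suc (R n)) (u n)" "has_order (S n) (vfield_multiplier (u n))" by auto
      have "has_order (Suc (S n + R n)) (u (Suc n))" "has_order (?p * S n) (vfield_multiplier (u (Suc n)))"
        using step approx[OF step(1)] bounds[of n] by (rule vfield_power_card_step)+
      then show ?case by (simp add: R_Suc S_def mult_ac)
    qed (use order_0 c in simp)
    then show ?thesis by simp
  qed
  moreover have "has_order (S 0) (vfield_multiplier (u 0))" if "has_order (Suc (R 1)) (u 1)"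
  proof -
    \<comment> \<open>The approximation error lies beyond the leading term of \<open>u 1\<close>, so
      \<open>D ^ p X\<close> has the same order, and dividing by \<open>u 0\<close> gives that of
      the multiplier.\<close>
    have "Suc (Suc (R 1)) \<le> Suc ((2 * ?p - 1) * R 0)"
      using bounds(1)[of 0] R_Suc[of 0] by simp
    then have "fps_X ^ Suc (Suc (R 1)) dvd (vfield (u 0) ^^ ?p) fps_X - u 1"
      using fps_X_power_dvd_mono[OF approx[OF order_0]] unfolding One_nat_def
      by (subst dvd_diff_commute) blast
    with that have "has_order (Suc (R 1)) ((vfield (u 0) ^^ ?p) fps_X)" by (rule has_order_cong)
    then show ?thesis
      using has_order_vfield_power_card_iff[OF order_0, of "S 0"] R_Suc[of 0] by simp
  qed
  moreover have "ramification_number n f = enat (R n) \<longleftrightarrow> has_order (Suc (R n)) (u n)" for n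
    using ramification_number_eq_iff[OF p f] by (simp add: u_def F_def)
  ultimately show ?thesis unfolding u0 S0 R_def by blast
qed

theorem theorem1:
  fixes a :: "nat \<Rightarrow> 'p::prime_card mod_ring"
    and f :: "'p mod_ring fps"
  assumes "CARD('p) > 3"
    and "f = fps_X + Abs_fps (\<lambda>k. if k \<ge> 4 then a (k - 3) else 0)"
    and "f \<in> nottingham"
    and "\<forall>m\<ge>1. fps_iterate f m \<noteq> fps_X"
  shows "(\<forall>n. ramification_number n f = enat (3 * (\<Sum>k\<le>n. CARD('p) ^ k)))
     \<longleftrightarrow> a 1 \<noteq> 0 \<and> 2 * a 1 ^ 4 - a 2 ^ 3 + 2 * a 1 * a 2 * a 3 - a 1 ^ 2 * a 4 \<noteq> 0"
proof -
  define u where "u = trunc_log f fps_X"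
  have f0: "fps_nth f 0 = 0" using assms(3) by (simp add: nottingham_def)
  have f_nth: "fps_nth f k = a (k - 3)" if "4 \<le> k" for k using that by (simp add: assms(2))
  have "fps_X ^ 4 dvd f - fps_X"
    by (simp add: assms(2) fps_X_power_dvd_iff)
  note coeffs = trunc_log_coeffs[OF assms(1) f0 this, folded u_def]
  have order_4: "has_order 4 u \<longleftrightarrow> a 1 \<noteq> 0"
    using coeffs(1,2) by (simp add: has_order_def f_nth)
  show ?thesis
  proof (cases "a 1 = 0")
    case True
    \<comment> \<open>If the leading coefficient vanishes, the claimed value already fails at
      \<open>n = 0\<close>.\<close>
    have "ramification_number 0 f \<noteq> enat 3"
      using order_4 True f0 unfolding ramification_number_eq_iff[OF assms(1,3)]
      by (simp add: u_def fps_iterate_1)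
    then show ?thesis using True by (auto intro!: exI[of _ 0])
  next
    case False
    then have u: "has_order 4 u" using order_4 by simp
    \<comment> \<open>The correction \<open>- 2 * a 1 ^ 2\<close>, the second-order term of the
      logarithm, produces the summand \<open>2 * a 1 ^ 4\<close> of the criterion.\<close>
    have b: "fps_nth u (3 + 1) = a 1" "fps_nth u (3 + 2) = a 2" "fps_nth u (3 + 3) = a 3"
      "fps_nth u (3 + 4) = a 4 - 2 * a 1 ^ 2"
      using coeffs by (simp_all add: f_nth)
    have "(\<forall>n. ramification_number n f = enat (3 * (\<Sum>k\<le>n. CARD('p) ^ k)))
      \<longleftrightarrow> a 2 ^ 3 - 2 * a 1 * a 2 * a 3 + a 1 ^ 2 * (a 4 - 2 * a 1 ^ 2) \<noteq> 0"
      using ramification_numbers_iff_multiplier[OF assms(1,3), folded u_def, OF u]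
        vfield_multiplier_order[OF assms(1) u]
      unfolding b by simp
    also have "a 2 ^ 3 - 2 * a 1 * a 2 * a 3 + a 1 ^ 2 * (a 4 - 2 * a 1 ^ 2)
      = - (2 * a 1 ^ 4 - a 2 ^ 3 + 2 * a 1 * a 2 * a 3 - a 1 ^ 2 * a 4)"
      by (simp add: algebra_simps eval_nat_numeral)
    finally show ?thesis using False unfolding neg_equal_0_iff_equal by blast
  qed
qed

end
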